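(* Let $G$ be a countably infinite group with Kazhdan's property (T), let $\sigma\in Z^2(G,\mathbb{T})$ and let $x_0\in C_r^*(G,\sigma)$. Then, for any choice of $d\in ND_0^+(G)$, the set $I^{d,\sigma}_{x_0}:=\{t\ge0: M_t^d(x_0)\in CF(G,\sigma)\}$ satisfies \[ I^{d,\sigma}_{x_0}=\begin{cases}[0,\infty)&\text{if }x_0\in CF(G,\sigma),\\ \emptyset&\text{otherwise.}\end{cases}\]
   Context: $Z^2(G,\mathbb{T})$ is the group of normalized 2-cocycles $\sigma:G\times G\to\mathbb{T}$ (i.e. $\sigma(g,h)\sigma(gh,k)=\sigma(h,k)\sigma(g,hk)$, $\sigma(g,e)=\sigma(e,g)=1$). $\Lambda_\sigma$ is the left regular $\sigma$-projective representation on $\ell^2(G)$: $\Lambda_\sigma(g)\delta_h=\sigma(g,h)\delta_{gh}$. $C_r^*(G,\sigma)$ is the operator-norm closure in $\mathcal{B}(\ell^2(G))$ of $\mathrm{Span}(\Lambda_\sigma(G))$. For $x\in C_r^*(G,\sigma)$, $\widehat{x}:=x\delta_e\in\ell^2(G)$, and the Fourier series of $x$ is $\sum_{g\in G}\widehat{x}(g)\Lambda_\sigma(g)$. Convergence of a series $\sum_{g\in G}x_g$ means unordered convergence in operator norm: convergence of the net of finite partial sums indexed by the finite subsets of $G$ directed by inclusion. $CF(G,\sigma)$ is the set of $x\in C_r^*(G,\sigma)$ whose Fourier series is convergent. $ND_0^+(G)$ is the set of functions $d:G\to[0,\infty)$ with $d(e)=0$ that are negative definite: $d(g^{-1})=d(g)$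 for all $g$, and $\sum_{i,j=1}^n\overline{b_i}b_j\,d(g_i^{-1}g_j)\le 0$ for all $n$, $g_1,\dots,g_n\in G$ and $b_1,\dots,b_n\in\mathbb{C}$ with $\sum_i b_i=0$. For $d\in ND_0^+(G)$ and $t\ge0$, $M_t^d$ denotes the (well-defined, unital, completely positive) bounded linear operator on $C_r^*(G,\sigma)$ determined by $M_t^d(\Lambda_\sigma(g))=e^{-td(g)}\Lambda_\sigma(g)$ for all $g\in G$. It is known that $G$ has property (T) if and only if every $d\in ND_0^+(G)$ is bounded. *)

theory Defs
  imports "HOL-Analysis.Analysis"
begin

section \<open>The complex Hilbert space of square-summable families\<close>

typedef 'a ell2 = "{f :: 'a \<Rightarrow> complex. (\<lambda>i. (cmod (f i))\<^sup>2) summable_on UNIV}"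
  morphisms coord Abs_ell2
  by (rule exI[of _ "\<lambda>_. 0"]) simp

setup_lifting type_definition_ell2

lemma coord_summable: "(\<lambda>i. (cmod (coord x i))\<^sup>2) summable_on UNIV"
  using coord[of x] by simp

lemma ell2_eqI: "(\<And>i. coord x i = coord y i) \<Longrightarrow> x = y"
  by (metis coord_inject ext)

lemma sq_summable_add:
  fixes f g :: "'a \<Rightarrow> complex"
  assumes "(\<lambda>i. (cmod (f i))\<^sup>2) summable_on UNIV" "(\<lambda>i. (cmod (g i))\<^sup>2) summable_on UNIV"
  shows "(\<lambda>i. (cmod (f i + g i))\<^sup>2) summable_on UNIV"
proof (rule summable_on_comparison_test)
  show "(\<lambda>i. 2 * (cmod (f i))\<^sup>2 + 2 * (cmod (g i))\<^sup>2) summable_on UNIV"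
    using assms by (intro summable_on_add summable_on_cmult_right)
next
  fix i
  have "(cmod (f i + g i))\<^sup>2 \<le> (cmod (f i) + cmod (g i))\<^sup>2"
    by (intro power_mono norm_triangle_ineq) auto
  also have "\<dots> \<le> 2 * (cmod (f i))\<^sup>2 + 2 * (cmod (g i))\<^sup>2"
    using zero_le_power2[of "cmod (f i) - cmod (g i)"]
    by (simp add: power2_sum power2_diff)
  finally show "(cmod (f i + g i))\<^sup>2 \<le> 2 * (cmod (f i))\<^sup>2 + 2 * (cmod (g i))\<^sup>2" .
qed auto

lemma sq_summable_mult:
  fixes f :: "'a \<Rightarrow> complex"
  assumes "(\<lambda>i. (cmod (f i))\<^sup>2) summable_on UNIV"
  shows "(\<lambda>i. (cmod (c * f i))\<^sup>2) summable_on UNIV"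
  using assms by (simp add: norm_mult power_mult_distrib summable_on_cmult_right)

lemma inner_summable:
  "(\<lambda>i. inner (coord x i) (coord y i)) summable_on UNIV"
proof -
  have "(\<lambda>i. (cmod (coord x i + coord y i))\<^sup>2
      + - ((cmod (coord x i))\<^sup>2 + (cmod (coord y i))\<^sup>2)) summable_on UNIV"
    by (intro summable_on_add summable_on_uminus[THEN iffD2] sq_summable_add coord_summable)
  then have "(\<lambda>i. (1/2) * ((cmod (coord x i + coord y i))\<^sup>2
      + - ((cmod (coord x i))\<^sup>2 + (cmod (coord y i))\<^sup>2))) summable_on UNIV"
    by (rule summable_on_cmult_right)
  moreover have "(1/2) * ((cmod (a + b))\<^sup>2 + - ((cmod a)\<^sup>2 + (cmod b)\<^sup>2)) = inner a b" for a b :: complex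
    by (simp add: power2_norm_eq_inner inner_add_left inner_add_right inner_commute)
  ultimately show ?thesis by (simp only:)
qed

instantiation ell2 :: (type) real_inner
begin

lift_definition zero_ell2 :: "'a ell2" is "\<lambda>_. 0" by simp

lift_definition plus_ell2 :: "'a ell2 \<Rightarrow> 'a ell2 \<Rightarrow> 'a ell2" is "\<lambda>f g i. f i + g i"
  by (rule sq_summable_add)

lift_definition uminus_ell2 :: "'a ell2 \<Rightarrow> 'a ell2" is "\<lambda>f i. - f i" by simp

lift_definition minus_ell2 :: "'a ell2 \<Rightarrow> 'a ell2 \<Rightarrow> 'a ell2" is "\<lambda>f g i. f i - g i"
  subgoal for f g using sq_summable_add[of f "\<lambda>i. - g i"] by simp
  done

lift_definition scaleR_ell2 :: "real \<Rightarrow> 'a ell2 \<Rightarrow> 'a ell2" is "\<lambda>r f i. complex_of_real r * f i"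
  by (rule sq_summable_mult)

definition inner_ell2 :: "'a ell2 \<Rightarrow> 'a ell2 \<Rightarrow> real" where
  "inner_ell2 x y = (\<Sum>\<^sub>\<infinity>i. inner (coord x i) (coord y i))"

definition norm_ell2 :: "'a ell2 \<Rightarrow> real" where
  "norm_ell2 x = sqrt (\<Sum>\<^sub>\<infinity>i. (cmod (coord x i))\<^sup>2)"

definition dist_ell2 :: "'a ell2 \<Rightarrow> 'a ell2 \<Rightarrow> real" where
  "dist_ell2 x y = norm (x - y)"

definition sgn_ell2 :: "'a ell2 \<Rightarrow> 'a ell2" where
  "sgn_ell2 x = inverse (norm x) *\<^sub>R x"

definition uniformity_ell2 :: "('a ell2 \<times> 'a ell2) filter" where
  "uniformity_ell2 = (INF e\<in>{0<..}. principal {(x, y). dist x y < e})"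

definition open_ell2 :: "'a ell2 set \<Rightarrow> bool" where
  "open_ell2 U = (\<forall>x\<in>U. \<forall>\<^sub>F (x', y) in uniformity. x' = x \<longrightarrow> y \<in> U)"

instance
proof
  fix x y z :: "'a ell2" and r s :: real
  show "x + y + z = x + (y + z)" "x + y = y + x" "0 + x = x" "- x + x = 0" "x - y = x + - y"
    "r *\<^sub>R (x + y) = r *\<^sub>R x + r *\<^sub>R y" "(r + s) *\<^sub>R x = r *\<^sub>R x + s *\<^sub>R x"
    "r *\<^sub>R s *\<^sub>R x = (r * s) *\<^sub>R x" "1 *\<^sub>R x = x"
    by (transfer; simp add: algebra_simps)+
  show "sgn x = inverse (norm x) *\<^sub>R x" by (rule sgn_ell2_def)
  show "dist x y = norm (x - y)" by (rule dist_ell2_def)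
  show "uniformity = (INF e\<in>{0<..}. principal {(x :: 'a ell2, y). dist x y < e})"
    by (rule uniformity_ell2_def)
  show "open U = (\<forall>x\<in>U. \<forall>\<^sub>F (x', y) in uniformity. x' = x \<longrightarrow> y \<in> U)" for U :: "'a ell2 set"
    by (rule open_ell2_def)
  show "inner x y = inner y x"
    by (simp add: inner_ell2_def inner_commute)
  show "inner (x + y) z = inner x z + inner y z"
    unfolding inner_ell2_def
    by (simp add: plus_ell2.rep_eq inner_add_left infsum_add inner_summable)
  show "inner (r *\<^sub>R x) y = r * inner x y"
    unfolding inner_ell2_def
    by (simp add: scaleR_ell2.rep_eq flip: scaleR_conv_of_real infsum_cmult_right')
  show "0 \<le> inner x x"
    unfolding inner_ell2_def by (rule infsum_nonneg) simp
  show "norm x = sqrt (inner x x)"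
    by (simp add: norm_ell2_def inner_ell2_def power2_norm_eq_inner)
  show "inner x x = 0 \<longleftrightarrow> x = 0"
  proof
    assume "inner x x = 0"
    then have *: "(\<Sum>\<^sub>\<infinity>i. inner (coord x i) (coord x i)) = 0"
      by (simp add: inner_ell2_def)
    have "inner (coord x i) (coord x i) = 0" for i
      by (rule nonneg_infsum_le_0D[OF _ inner_summable]) (use * in auto)
    then show "x = 0" by (intro ell2_eqI) (simp add: zero_ell2.rep_eq)
  qed (simp add: inner_ell2_def zero_ell2.rep_eq)
qed

end

lift_definition cscale :: "complex \<Rightarrow> 'a ell2 \<Rightarrow> 'a ell2"  (infixr \<open>*\<^sub>C\<close> 75)
  is "\<lambda>c f i. c * f i"
  by (rule sq_summable_mult)

definition cinner :: "'a ell2 \<Rightarrow> 'a ell2 \<Rightarrow> complex" where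
  "cinner x y = (\<Sum>\<^sub>\<infinity>i. cnj (coord x i) * coord y i)"

lift_definition delta :: "'a \<Rightarrow> 'a ell2" is "\<lambda>h i. if i = h then 1 else 0"
  by (rule finite_nonzero_values_imp_summable_on) (auto intro: finite_subset)

lemma norm_cscale: "norm (c *\<^sub>C x) = cmod c * norm x"
  by (simp add: norm_ell2_def cscale.rep_eq norm_mult power_mult_distrib infsum_cmult_right'
      real_sqrt_mult)

lemma cscale_complex_of_real: "complex_of_real r *\<^sub>C x = r *\<^sub>R x"
  by transfer simp

lemma bounded_linear_cscale: "bounded_linear (\<lambda>x. c *\<^sub>C x)"
proof (rule bounded_linear_intro[where K = "cmod c"])
  show "c *\<^sub>C (x + y) = c *\<^sub>C x + c *\<^sub>C y" for x y :: "'a ell2"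
    by transfer (simp add: algebra_simps)
  show "c *\<^sub>C (r *\<^sub>R x) = r *\<^sub>R (c *\<^sub>C x)" for r and x :: "'a ell2"
    by transfer (simp add: algebra_simps)
  show "norm (c *\<^sub>C x) \<le> norm x * cmod c" for x :: "'a ell2"
    by (simp add: norm_cscale)
qed

text \<open>
  Operators on \<open>\<ell>\<^sup>2\<close> are elements of the real normed space \<open>'a ell2 \<Rightarrow>\<^sub>L 'a ell2\<close>, whose norm is
  the usual operator norm.  The complex-linear operators form a closed subspace of it, which
  contains everything considered below.
\<close>

definition op_cscale :: "complex \<Rightarrow> ('a ell2 \<Rightarrow>\<^sub>L 'a ell2) \<Rightarrow> 'a ell2 \<Rightarrow>\<^sub>L 'a ell2"
  (infixr \<open>*\<^sub>O\<close> 75) where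
  "c *\<^sub>O T = Blinfun (\<lambda>\<xi>. c *\<^sub>C blinfun_apply T \<xi>)"

lemma op_cscale_apply: "blinfun_apply (c *\<^sub>O T) \<xi> = c *\<^sub>C blinfun_apply T \<xi>"
  unfolding op_cscale_def
  using bounded_linear_compose[OF bounded_linear_cscale[of c] blinfun.bounded_linear_right[of T]]
  by (simp add: bounded_linear_Blinfun_apply)


section \<open>Twisted reduced group C*-algebras\<close>

text \<open>
  Groups are types of class \<^class>\<open>group_add\<close>, the library's class of not necessarily commutative
  groups.  Its notation is additive: \<open>g + h\<close> is the product, \<open>- g\<close> the inverse and \<open>0\<close> the
  neutral element.
\<close>

definition cocycles :: "('g::group_add \<Rightarrow> 'g \<Rightarrow> complex) set"  (\<open>Z\<^sup>2\<close>) where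
  "Z\<^sup>2 = {\<sigma>. (\<forall>g h. cmod (\<sigma> g h) = 1) \<and>
            (\<forall>g h k. \<sigma> g h * \<sigma> (g + h) k = \<sigma> h k * \<sigma> g (h + k)) \<and>
            (\<forall>g. \<sigma> g 0 = 1 \<and> \<sigma> 0 g = 1)}"

text \<open>
  The formula is \<open>(\<Lambda>\<^sub>\<sigma>(g) \<xi>)(k) = \<sigma>(g, g\<inverse>k) \<xi>(g\<inverse>k)\<close>; the lemmas \<open>coord_Lam\<close> and \<open>Lam_delta\<close>
  below confirm that it is a well-defined bounded operator for a cocycle and has the defining
  values on the basis.
\<close>

definition Lam :: "('g::group_add \<Rightarrow> 'g \<Rightarrow> complex) \<Rightarrow> 'g \<Rightarrow> 'g ell2 \<Rightarrow>\<^sub>L 'g ell2" where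
  "Lam \<sigma> g = Blinfun (\<lambda>\<xi>. Abs_ell2 (\<lambda>k. \<sigma> g (- g + k) * coord \<xi> (- g + k)))"

definition Cr :: "('g::group_add \<Rightarrow> 'g \<Rightarrow> complex) \<Rightarrow> ('g ell2 \<Rightarrow>\<^sub>L 'g ell2) set" where
  "Cr \<sigma> = closure {\<Sum>g\<in>F. c g *\<^sub>O Lam \<sigma> g | F c. finite F}"

definition fourier :: "('g::group_add ell2 \<Rightarrow>\<^sub>L 'g ell2) \<Rightarrow> 'g \<Rightarrow> complex" where
  "fourier x = coord (blinfun_apply x (delta 0))"

definition CF :: "('g::group_add \<Rightarrow> 'g \<Rightarrow> complex) \<Rightarrow> ('g ell2 \<Rightarrow>\<^sub>L 'g ell2) set" where
  "CF \<sigma> = {x \<in> Cr \<sigma>. (\<lambda>g. fourier x g *\<^sub>O Lam \<sigma> g) summable_on UNIV}"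

lemma bij_translation: "bij (\<lambda>k. - g + k)" for g :: "'g::group_add"
  by (rule bij_betw_byWitness[where f' = "\<lambda>k. g + k"]) (auto simp: add.assoc[symmetric])

lemma Lam_square_summable:
  fixes \<sigma> :: "'g::group_add \<Rightarrow> 'g \<Rightarrow> complex"
  assumes "\<sigma> \<in> Z\<^sup>2"
  shows "(\<lambda>k. (cmod (\<sigma> g (- g + k) * coord \<xi> (- g + k)))\<^sup>2) summable_on UNIV"
proof -
  have "(\<lambda>k. (cmod (coord \<xi> (- g + k)))\<^sup>2) summable_on UNIV"
    using summable_on_reindex_bij_betw[OF bij_translation, of "\<lambda>k. (cmod (coord \<xi> k))\<^sup>2" g]
    by (simp add: coord_summable)
  then show ?thesis
    using assms by (simp add: cocycles_def norm_mult)
qed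

lemma bounded_linear_Lam:
  fixes \<sigma> :: "'g::group_add \<Rightarrow> 'g \<Rightarrow> complex"
  assumes \<sigma>: "\<sigma> \<in> Z\<^sup>2"
  shows "bounded_linear (\<lambda>\<xi>. Abs_ell2 (\<lambda>k. \<sigma> g (- g + k) * coord \<xi> (- g + k)))"
proof -
  define T where "T = (\<lambda>\<xi>. Abs_ell2 (\<lambda>k. \<sigma> g (- g + k) * coord \<xi> (- g + k)))"
  have T: "coord (T \<xi>) k = \<sigma> g (- g + k) * coord \<xi> (- g + k)" for \<xi> k
    unfolding T_def using Lam_square_summable[OF \<sigma>] by (subst Abs_ell2_inverse) auto
  have "bounded_linear T"
  proof (rule bounded_linear_intro[where K = 1])
    show "T (x + y) = T x + T y" for x y
      by (rule ell2_eqI) (simp add: T plus_ell2.rep_eq algebra_simps)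
    show "T (r *\<^sub>R x) = r *\<^sub>R T x" for r x
      by (rule ell2_eqI) (simp add: T scaleR_ell2.rep_eq)
    show "norm (T x) \<le> norm x * 1" for x
    proof -
      have "(\<Sum>\<^sub>\<infinity>k. (cmod (coord x (- g + k)))\<^sup>2) = (\<Sum>\<^sub>\<infinity>k. (cmod (coord x k))\<^sup>2)"
        by (rule infsum_reindex_bij_betw[OF bij_translation])
      then show ?thesis
        using \<sigma> by (simp add: norm_ell2_def T norm_mult cocycles_def)
    qed
  qed
  then show ?thesis by (simp add: T_def)
qed

lemma coord_Lam:
  assumes "\<sigma> \<in> Z\<^sup>2"
  shows "coord (blinfun_apply (Lam \<sigma> g) \<xi>) k = \<sigma> g (- g + k) * coord \<xi> (- g + k)"
  unfolding Lam_def bounded_linear_Blinfun_apply[OF bounded_linear_Lam[OF assms]]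
  using Lam_square_summable[OF assms] by (subst Abs_ell2_inverse) auto

lemma Lam_delta:
  assumes "\<sigma> \<in> Z\<^sup>2"
  shows "blinfun_apply (Lam \<sigma> g) (delta h) = \<sigma> g h *\<^sub>C delta (g + h)"
proof (rule ell2_eqI)
  fix k
  have "- g + k = h \<longleftrightarrow> k = g + h"
    by (metis add.assoc add.left_inverse add.right_inverse add_0)
  then show "coord (blinfun_apply (Lam \<sigma> g) (delta h)) k = coord (\<sigma> g h *\<^sub>C delta (g + h)) k"
    by (auto simp: coord_Lam[OF assms] cscale.rep_eq delta.rep_eq)
qed


section \<open>Negative definite functions and their multiplier semigroups\<close>

text \<open>
  The sum below is a real number because of \<open>d (- g) = d g\<close>, so the real part only converts it
  to type \<^typ>\<open>real\<close>.
\<close>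

definition neg_definite :: "('g::group_add \<Rightarrow> real) set"  (\<open>ND\<^sub>0\<^sup>+\<close>) where
  "ND\<^sub>0\<^sup>+ = {d. (\<forall>g. 0 \<le> d g) \<and> d 0 = 0 \<and> (\<forall>g. d (- g) = d g) \<and>
     (\<forall>(n::nat) (g :: nat \<Rightarrow> 'g) (b :: nat \<Rightarrow> complex). (\<Sum>i<n. b i) = 0 \<longrightarrow>
        Re (\<Sum>i<n. \<Sum>j<n. cnj (b i) * b j * complex_of_real (d (- g i + g j))) \<le> 0)}"

definition bounded_operator_on_Cr ::
    "('g::group_add \<Rightarrow> 'g \<Rightarrow> complex) \<Rightarrow> (('g ell2 \<Rightarrow>\<^sub>L 'g ell2) \<Rightarrow> 'g ell2 \<Rightarrow>\<^sub>L 'g ell2) \<Rightarrow> bool" where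
  "bounded_operator_on_Cr \<sigma> M \<longleftrightarrow>
     (\<forall>x\<in>Cr \<sigma>. M x \<in> Cr \<sigma>) \<and>
     (\<forall>x\<in>Cr \<sigma>. \<forall>y\<in>Cr \<sigma>. M (x + y) = M x + M y) \<and>
     (\<forall>c. \<forall>x\<in>Cr \<sigma>. M (c *\<^sub>O x) = c *\<^sub>O M x) \<and>
     (\<exists>C. \<forall>x\<in>Cr \<sigma>. norm (M x) \<le> C * norm x)"

text \<open>
  The two conditions determine the values on \<^term>\<open>Cr \<sigma>\<close>, the closed span of the \<^term>\<open>Lam \<sigma> g\<close>;
  the choice operator leaves open only the irrelevant values outside \<^term>\<open>Cr \<sigma>\<close>.
\<close>

definition multiplier :: "('g::group_add \<Rightarrow> 'g \<Rightarrow> complex) \<Rightarrow> ('g \<Rightarrow> real) \<Rightarrow> real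
    \<Rightarrow> ('g ell2 \<Rightarrow>\<^sub>L 'g ell2) \<Rightarrow> 'g ell2 \<Rightarrow>\<^sub>L 'g ell2" where
  "multiplier \<sigma> d t = (SOME M. bounded_operator_on_Cr \<sigma> M \<and>
     (\<forall>g. M (Lam \<sigma> g) = complex_of_real (exp (- t * d g)) *\<^sub>O Lam \<sigma> g))"

definition conv_times :: "('g::group_add \<Rightarrow> 'g \<Rightarrow> complex) \<Rightarrow> ('g \<Rightarrow> real)
    \<Rightarrow> ('g ell2 \<Rightarrow>\<^sub>L 'g ell2) \<Rightarrow> real set" where
  "conv_times \<sigma> d x = {t. 0 \<le> t \<and> multiplier \<sigma> d t x \<in> CF \<sigma>}"


section \<open>Kazhdan's property (T)\<close>

text \<open>
  Unitary representations are taken on closed subspaces \<open>H\<close> of \<open>\<ell>\<^sup>2(\<nat>)\<close>, i.e. up to equivalence on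
  all separable Hilbert spaces.  For a countable group this loses nothing: any representation
  with an almost invariant vector and no nonzero invariant vector restricts to one with the same
  property on the closed span of the orbit of that vector, which is separable.  Unitarity of the
  maps \<open>\<pi> g\<close> is preservation of the inner product together with the invertibility coming from
  the homomorphism property.
\<close>

definition unitary_rep :: "nat ell2 set \<Rightarrow> ('g::group_add \<Rightarrow> nat ell2 \<Rightarrow> nat ell2) \<Rightarrow> bool" where
  "unitary_rep H \<pi> \<longleftrightarrow>
     closed H \<and> 0 \<in> H \<and> (\<forall>\<xi>\<in>H. \<forall>\<eta>\<in>H. \<xi> + \<eta> \<in> H) \<and> (\<forall>c. \<forall>\<xi>\<in>H. c *\<^sub>C \<xi> \<in> H) \<and>
     (\<forall>g. \<forall>\<xi>\<in>H. \<pi> g \<xi> \<in> H) \<and>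
     (\<forall>g. \<forall>\<xi>\<in>H. \<forall>\<eta>\<in>H. \<pi> g (\<xi> + \<eta>) = \<pi> g \<xi> + \<pi> g \<eta>) \<and>
     (\<forall>g c. \<forall>\<xi>\<in>H. \<pi> g (c *\<^sub>C \<xi>) = c *\<^sub>C \<pi> g \<xi>) \<and>
     (\<forall>g. \<forall>\<xi>\<in>H. \<forall>\<eta>\<in>H. cinner (\<pi> g \<xi>) (\<pi> g \<eta>) = cinner \<xi> \<eta>) \<and>
     (\<forall>\<xi>\<in>H. \<pi> 0 \<xi> = \<xi>) \<and>
     (\<forall>g h. \<forall>\<xi>\<in>H. \<pi> (g + h) \<xi> = \<pi> g (\<pi> h \<xi>))"

text \<open>The group is discrete, so its compact subsets are the finite ones.\<close>

definition property_T :: "'g::group_add itself \<Rightarrow> bool" where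
  "property_T _ \<longleftrightarrow> (\<exists>(K :: 'g set) \<epsilon>. finite K \<and> \<epsilon> > 0 \<and>
     (\<forall>H (\<pi> :: 'g \<Rightarrow> nat ell2 \<Rightarrow> nat ell2). unitary_rep H \<pi> \<longrightarrow>
        (\<exists>\<xi>\<in>H. \<xi> \<noteq> 0 \<and> (\<forall>g\<in>K. norm (\<pi> g \<xi> - \<xi>) < \<epsilon> * norm \<xi>)) \<longrightarrow>
        (\<exists>\<xi>\<in>H. \<xi> \<noteq> 0 \<and> (\<forall>g. \<pi> g \<xi> = \<xi>))))"

end

theory Submission
  imports Defs
begin

text \<open>
  By Schoenberg's theorem \<open>e\<^sup>-\<^sup>t\<^sup>d\<close> is positive definite. Its GNS representation contains a vector
  moved by \<open>g\<close> over the squared distance \<open>2 - 2 e\<^sup>-\<^sup>t\<^sup>d\<^sup>(\<^sup>g\<^sup>)\<close>. For small \<open>t\<close> this vector is almost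
  invariant, so property (T) puts it close to an invariant vector and it is moved little by all of
  \<open>G\<close>; hence \<open>d\<close> is bounded. The Fourier coefficients of \<open>x\<close> and of its image under the multiplier
  then differ by the factors \<open>e\<^sup>-\<^sup>t\<^sup>d\<^sup>(\<^sup>g\<^sup>)\<close>, which lie between two positive constants, and unordered
  convergence is insensitive to bounded factors.
\<close>

text \<open>Real kernels suffice because \<open>d\<close> is real and symmetric; complex scalars
  enter only through the Hilbert spaces. \<open>property_T\<close> quantifies over representations
  on closed subspaces of \<open>nat ell2\<close>, so the GNS space has to be built inside that space
  and not as an abstract completion. A triangular Gram factorisation does this: it writes a positive
  semidefinite kernel on a countable set as inner products of real sequences of finite support. The
  same factorisation serves twice more: it yields the Schur product theorem, hence positivity of the
  exponential, and it bounds the multiplier on finite sums by placing the operator between diagonal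
  operators \<open>D i\<close>. That bound matters because \<open>multiplier\<close> is selected by
  a choice operator: its Fourier coefficients are known only once some operator with the prescribed
  values exists. For the final comparison, unordered norm convergence does not imply absolute
  convergence, so norms cannot be compared term by term; convexity takes the place of that
  comparison.\<close>

section \<open>Positive semidefinite kernels\<close>

text \<open>The points \<open>g i\<close> may repeat, which makes the notion stable under arbitrary pullbacks.\<close>

definition psd :: "('a \<Rightarrow> 'a \<Rightarrow> real) \<Rightarrow> bool" where
  "psd A \<longleftrightarrow> (\<forall>x y. A x y = A y x) \<and>
     (\<forall>(n::nat) (g :: nat \<Rightarrow> 'a) b. 0 \<le> (\<Sum>i<n. \<Sum>j<n. b i * b j * A (g i) (g j)))"

lemma psd_sym: "psd A \<Longrightarrow> A x y = A y x"
  by (simp add: psd_def)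

lemma psd_form:
  fixes g :: "nat \<Rightarrow> 'a"
  shows "psd A \<Longrightarrow> 0 \<le> (\<Sum>i<n. \<Sum>j<n. b i * b j * A (g i) (g j))"
  by (simp add: psd_def)

lemma psd_comp: "psd A \<Longrightarrow> psd (\<lambda>x y. A (f x) (f y))"
  unfolding psd_def by (metis (mono_tags))

lemma psd_diag: "psd A \<Longrightarrow> 0 \<le> A x x"
  using psd_form[where n = 1 and b = "\<lambda>_. 1" and g = "\<lambda>_. x"] by simp

lemma quadratic_form_Suc:
  fixes g :: "nat \<Rightarrow> 'a" and A :: "'a \<Rightarrow> 'a \<Rightarrow> real"
  assumes "\<And>x y. A x y = A y x"
  shows "(\<Sum>i<Suc n. \<Sum>j<Suc n. b i * b j * A (g i) (g j)) =
    (\<Sum>i<n. \<Sum>j<n. b i * b j * A (g i) (g j)) + 2 * b n * (\<Sum>i<n. b i * A (g i) (g n))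
      + (b n)\<^sup>2 * A (g n) (g n)"
proof -
  have "(\<Sum>j<n. b n * b j * A (g n) (g j)) = (\<Sum>i<n. b i * b n * A (g i) (g n))"
    using assms by (intro sum.cong) (auto simp: mult.commute)
  then show ?thesis
    by (simp add: sum.distrib sum_distrib_left power2_eq_square algebra_simps)
qed

text \<open>Adjoining the point \<open>k\<close> with weight \<open>s\<close> turns positivity into
  nonnegativity of a quadratic polynomial in \<open>s\<close>. Suitable values of \<open>s\<close>
  give \<open>psd_zero\<close> and \<open>psd_schur_complement\<close>.\<close>

lemma psd_extend:
  fixes g :: "nat \<Rightarrow> 'a"
  assumes "psd A"
  shows "0 \<le> (\<Sum>i<n. \<Sum>j<n. b i * b j * A (g i) (g j))
    + 2 * s * (\<Sum>i<n. b i * A (g i) k) + s\<^sup>2 * A k k"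
proof -
  have "0 \<le> (\<Sum>i<Suc n. \<Sum>j<Suc n. (b(n:=s)) i * (b(n:=s)) j * A ((g(n:=k)) i) ((g(n:=k)) j))"
    by (rule psd_form[OF assms])
  then show ?thesis
    by (subst (asm) quadratic_form_Suc[OF psd_sym[OF assms]])
      (simp add: less_imp_neq cong: sum.cong_simp)
qed

lemma psd_zero:
  assumes "psd A" "A k k = 0"
  shows "A m k = 0"
proof (rule ccontr)
  assume *: "A m k \<noteq> 0"
  have "0 \<le> A m m + 2 * s * A m k" for s
    using psd_extend[OF assms(1), where n = 1 and b = "\<lambda>_. 1" and g = "\<lambda>_. m" and k = k and s = s]
      assms(2) by simp
  \<comment> \<open>This value of \<open>s\<close> makes the affine expression equal to -1.\<close>
  from this[of "-(A m m + 1) / (2 * A m k)"] * show False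
    by (simp add: field_simps)
qed

section \<open>Gram factorisation by symmetric elimination\<close>

text \<open>For the Gram kernel of a family of vectors this is the Gram kernel of their components
  orthogonal to the vector at \<open>k\<close>.\<close>

definition schur_complement :: "('a \<Rightarrow> 'a \<Rightarrow> real) \<Rightarrow> 'a \<Rightarrow> 'a \<Rightarrow> 'a \<Rightarrow> real" where
  "schur_complement A k = (\<lambda>x y. A x y - A x k * A y k / A k k)"

lemma psd_schur_complement:
  assumes "psd A"
  shows "psd (schur_complement A k)"
proof (cases "A k k = 0")
  case True
  with assms show ?thesis by (simp add: schur_complement_def)
next
  case False
  have "0 \<le> (\<Sum>i<n. \<Sum>j<n. b i * b j * schur_complement A k (g i) (g j))" for n b and g :: "nat \<Rightarrow> _"
  proof -
    let ?Q = "\<Sum>i<n. \<Sum>j<n. b i * b j * A (g i) (g j)"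
    let ?q = "\<Sum>i<n. b i * A (g i) k"
    have "(\<Sum>i<n. \<Sum>j<n. b i * b j * schur_complement A k (g i) (g j)) = ?Q - ?q * ?q / A k k"
      unfolding schur_complement_def sum_product sum_divide_distrib sum_subtractf[symmetric]
      by (intro sum.cong refl) (simp add: algebra_simps)
    \<comment> \<open>The polynomial of \<open>psd_extend\<close> at its minimum
      \<open>s = - ?q / A k k\<close>.\<close>
    also have "\<dots> = ?Q + 2 * (- ?q / A k k) * ?q + (- ?q / A k k)\<^sup>2 * A k k"
      using False by (simp add: field_simps power2_eq_square)
    also have "\<dots> \<ge> 0"
      by (rule psd_extend[OF assms])
    finally show ?thesis .
  qed
  then show ?thesis
    using psd_sym[OF assms] by (auto simp: psd_def schur_complement_def mult.commute)
qed

text \<open>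
  Subtracting rank-one kernels successively kills the rows \<open>0, 1, 2, \<dots>\<close>; the subtracted vectors
  form a lower triangular Gram factor. A vanishing pivot is harmless, since its row is then zero
  and \<open>x / 0 = 0\<close>.
\<close>

primrec cholesky_residual :: "(nat \<Rightarrow> nat \<Rightarrow> real) \<Rightarrow> nat \<Rightarrow> nat \<Rightarrow> nat \<Rightarrow> real" where
  "cholesky_residual A 0 = A"
| "cholesky_residual A (Suc k) = schur_complement (cholesky_residual A k) k"

lemma psd_cholesky_residual: "psd A \<Longrightarrow> psd (cholesky_residual A k)"
  by (induction k) (auto intro: psd_schur_complement)

lemma cholesky_residual_zero:
  assumes "psd A" "m < k"
  shows "cholesky_residual A k m n = 0"
  using assms(2)
proof (induction k arbitrary: m n)
  case (Suc k)
  let ?B = "cholesky_residual A k"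
  have B: "psd ?B" by (rule psd_cholesky_residual[OF assms(1)])
  show ?case
  proof (cases "m < k")
    case True
    then show ?thesis using Suc.IH by (simp add: schur_complement_def)
  next
    case False
    with Suc.prems have m: "m = k" by simp
    show ?thesis
      using psd_zero[OF B, of k n] psd_sym[OF B, of k n]
      by (cases "?B k k = 0") (auto simp: m schur_complement_def)
  qed
qed simp

text \<open>Row \<open>m\<close> of the residual is zero after more than \<open>m\<close> steps, so
  a finite sum already equals the kernel, for every \<open>n\<close>. Triangularity gives the
  factors finite support, which puts them into the Hilbert space whatever the size of the
  kernel.\<close>

lemma psd_gram:
  fixes A :: "nat \<Rightarrow> nat \<Rightarrow> real"
  assumes "psd A"
  obtains u :: "nat \<Rightarrow> nat \<Rightarrow> real"
  where "\<And>n k. n < k \<Longrightarrow> u n k = 0" "\<And>m n N. m < N \<Longrightarrow> (\<Sum>k<N. u m k * u n k) = A m n"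
proof -
  let ?B = "cholesky_residual A"
  define u where "u n k = ?B k n k / sqrt (?B k k k)" for n k
  have "?B N m n = A m n - (\<Sum>k<N. u m k * u n k)" for N m n
  proof (induction N)
    case (Suc N)
    \<comment> \<open>The pivot is nonnegative, so the two square roots multiply to the pivot
      itself; at pivot 0 both sides are 0.\<close>
    have "u m N * u n N = ?B N m N * ?B N n N / ?B N N N"
      using psd_diag[OF psd_cholesky_residual[OF assms, of N], of N] by (simp add: u_def)
    with Suc show ?case by (simp add: schur_complement_def)
  qed simp
  then have "(\<Sum>k<N. u m k * u n k) = A m n" if "m < N" for m n N
    using cholesky_residual_zero[OF assms that, of n] by (metis eq_iff_diff_eq_0)
  moreover have "u n k = 0" if "n < k" for n k
    using cholesky_residual_zero[OF assms that] by (simp add: u_def)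
  ultimately show ?thesis using that by blast
qed

section \<open>Sums, Schur products, limits and exponentials of kernels\<close>

lemma psd_add: "psd A \<Longrightarrow> psd B \<Longrightarrow> psd (\<lambda>x y. A x y + B x y)"
  by (auto simp: psd_def ring_distribs sum.distrib)

lemma psd_scale: "psd A \<Longrightarrow> 0 \<le> c \<Longrightarrow> psd (\<lambda>x y. c * A x y)"
proof -
  assume A: "psd A" and c: "0 \<le> c"
  have "(\<Sum>i<n. \<Sum>j<n. b i * b j * (c * A (g i) (g j))) = c * (\<Sum>i<n. \<Sum>j<n. b i * b j * A (g i) (g j))"
    for n b and g :: "nat \<Rightarrow> _"
    by (simp add: sum_distrib_left mult.left_commute)
  then show ?thesis using A c by (simp add: psd_def)
qed

lemma psd_rank_one: "psd (\<lambda>x y. f x * f y)"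
proof -
  have "(\<Sum>i<n. \<Sum>j<n. b i * b j * (f (g i) * f (g j))) = (\<Sum>i<n. b i * f (g i))\<^sup>2"
    for n b and g :: "nat \<Rightarrow> _"
    unfolding power2_eq_square sum_product by (intro sum.cong refl) (simp add: mult.assoc mult.left_commute)
  then show ?thesis by (simp add: psd_def mult.commute)
qed

text \<open>Schur product theorem: a Gram factorisation of \<open>A\<close> splits the quadratic
  form into a sum over \<open>k\<close> of quadratic forms of \<open>B\<close> with the weights
  \<open>b i * u i k\<close>.\<close>

lemma psd_mult:
  assumes "psd A" "psd B"
  shows "psd (\<lambda>x y. A x y * B x y)"
proof -
  have "0 \<le> (\<Sum>i<n. \<Sum>j<n. b i * b j * (A (g i) (g j) * B (g i) (g j)))" for n b and g :: "nat \<Rightarrow> _"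
  proof -
    obtain u where u: "\<And>m n N. m < N \<Longrightarrow> (\<Sum>k<N. u m k * u n k :: real) = A (g m) (g n)"
      using psd_gram[OF psd_comp[OF assms(1), of g]] by metis
    have "(\<Sum>i<n. \<Sum>j<n. b i * b j * (A (g i) (g j) * B (g i) (g j)))
        = (\<Sum>i<n. \<Sum>j<n. \<Sum>k<n. (b i * u i k) * (b j * u j k) * B (g i) (g j))"
    proof (intro sum.cong refl)
      fix i j assume "i \<in> {..<n}"
      then have "A (g i) (g j) = (\<Sum>k<n. u i k * u j k)" using u by simp
      then show "b i * b j * (A (g i) (g j) * B (g i) (g j))
          = (\<Sum>k<n. (b i * u i k) * (b j * u j k) * B (g i) (g j))"
        by (simp add: sum_distrib_left sum_distrib_right mult_ac)
    qed
    also have "\<dots> = (\<Sum>i<n. \<Sum>k<n. \<Sum>j<n. (b i * u i k) * (b j * u j k) * B (g i) (g j))"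
      by (intro sum.cong refl sum.swap)
    also have "\<dots> = (\<Sum>k<n. \<Sum>i<n. \<Sum>j<n. (b i * u i k) * (b j * u j k) * B (g i) (g j))"
      by (rule sum.swap)
    also have "\<dots> \<ge> 0"
      by (intro sum_nonneg psd_form[OF assms(2)])
    finally show ?thesis .
  qed
  then show ?thesis using psd_sym[OF assms(1)] psd_sym[OF assms(2)] by (simp add: psd_def)
qed

lemma psd_limit:
  assumes "\<And>N. psd (A N)" "\<And>x y. (\<lambda>N. A N x y) \<longlonglongrightarrow> B x y"
  shows "psd B"
proof -
  have "B x y = B y x" for x y
    using LIMSEQ_unique[OF assms(2)[of x y]] assms(2)[of y x] psd_sym[OF assms(1), of _ x y] by simp
  moreover have "0 \<le> (\<Sum>i<n. \<Sum>j<n. b i * b j * B (g i) (g j))" for n b and g :: "nat \<Rightarrow> _"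
  proof (rule LIMSEQ_le_const)
    show "(\<lambda>N. \<Sum>i<n. \<Sum>j<n. b i * b j * A N (g i) (g j)) \<longlonglongrightarrow> (\<Sum>i<n. \<Sum>j<n. b i * b j * B (g i) (g j))"
      by (intro tendsto_intros assms)
  qed (use psd_form[OF assms(1)] in auto)
  ultimately show ?thesis by (simp add: psd_def)
qed

text \<open>The exponential series has nonnegative coefficients, and the entrywise powers are
  handled by the Schur product theorem.\<close>

lemma psd_exp:
  assumes "psd A"
  shows "psd (\<lambda>x y. exp (A x y))"
proof (rule psd_limit)
  have pow: "psd (\<lambda>x y. A x y ^ k)" for k
    by (induction k) (use psd_rank_one[of "\<lambda>_. 1"] in \<open>auto intro: psd_mult assms\<close>)
  show "psd (\<lambda>x y. \<Sum>k<N. (1 / fact k) * A x y ^ k)" for N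
    by (induction N) (use psd_rank_one[of "\<lambda>_. 0"] in \<open>auto intro!: psd_add psd_scale pow simp del: times_divide_eq_left\<close>)
  show "(\<lambda>N. \<Sum>k<N. (1 / fact k) * A x y ^ k) \<longlonglongrightarrow> exp (A x y)" for x y
    using exp_converges[of "A x y"] by (simp add: sums_def divide_inverse mult.commute)
qed

text \<open>Points are numbered by an injection \<open>e\<close>. Numbers outside its range merely
  repeat points under \<open>inv e\<close>, and \<open>psd_comp\<close> allows this.\<close>

lemma psd_gram_countable:
  fixes A :: "'a \<Rightarrow> 'a \<Rightarrow> real"
  assumes "psd A" "countable (UNIV :: 'a set)"
  obtains u :: "'a \<Rightarrow> nat \<Rightarrow> real" and N :: "'a \<Rightarrow> nat"
  where "\<And>x k. N x \<le> k \<Longrightarrow> u x k = 0" "\<And>x y n. N x \<le> n \<Longrightarrow> (\<Sum>k<n. u x k * u y k) = A x y"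
proof -
  obtain e :: "'a \<Rightarrow> nat" where e: "inj e" using assms(2) by (rule countableE)
  obtain u where u: "\<And>n k. n < k \<Longrightarrow> u n k = (0::real)"
    "\<And>m n N. m < N \<Longrightarrow> (\<Sum>k<N. u m k * u n k) = A (inv e m) (inv e n)"
    using psd_gram[OF psd_comp[OF assms(1), of "inv e"]] by metis
  show ?thesis
    by (rule that[of "\<lambda>x. Suc (e x)" "\<lambda>x. u (e x)"]) (use u e in auto)
qed

section \<open>Hilbert space preliminaries\<close>

lemma sum_coord_le_norm:
  assumes "finite F"
  shows "(\<Sum>i\<in>F. (cmod (coord x i))\<^sup>2) \<le> (norm x)\<^sup>2"
  using finite_sum_le_infsum[OF coord_summable assms, of x]
  by (simp add: norm_ell2_def infsum_nonneg)

lemma norm_le_if_sum_coord_le: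
  assumes "\<And>F. finite F \<Longrightarrow> (\<Sum>i\<in>F. (cmod (coord x i))\<^sup>2) \<le> c\<^sup>2" "0 \<le> c"
  shows "norm x \<le> c"
proof -
  have "(\<Sum>\<^sub>\<infinity>i. (cmod (coord x i))\<^sup>2) \<le> c\<^sup>2"
    by (rule infsum_le_finite_sums[OF coord_summable]) (use assms in auto)
  then show ?thesis
    using assms(2) by (simp add: norm_ell2_def real_le_lsqrt infsum_nonneg)
qed

lemma coord_le_norm: "cmod (coord x i) \<le> norm x"
proof -
  have "(cmod (coord x i))\<^sup>2 \<le> (norm x)\<^sup>2" using sum_coord_le_norm[of "{i}" x] by simp
  then show ?thesis by (rule power2_le_imp_le) simp
qed

lemma bounded_linear_coord: "bounded_linear (\<lambda>x. coord x i)"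
  by (rule bounded_linear_intro[where K = 1])
    (auto simp: plus_ell2.rep_eq scaleR_ell2.rep_eq scaleR_conv_of_real coord_le_norm)

text \<open>The Cauchy estimate is uniform over finite sets of coordinates, so it survives the
  coordinatewise limit in one index. Completeness feeds the orthogonal projection, the extension of
  bounded operators and the Cauchy criterion for operator series.\<close>

instance ell2 :: (type) banach
proof
  fix X :: "nat \<Rightarrow> 'a ell2"
  assume X: "Cauchy X"
  have "convergent (\<lambda>n. coord (X n) i)" for i
    using bounded_linear.Cauchy[OF bounded_linear_coord X] by (rule Cauchy_convergent)
  then obtain f where f: "\<And>i. (\<lambda>n. coord (X n) i) \<longlonglongrightarrow> f i"
    unfolding convergent_def by metis
  have tail: "\<exists>N. \<forall>n\<ge>N. \<forall>F. finite F \<longrightarrow> (\<Sum>i\<in>F. (cmod (coord (X n) i - f i))\<^sup>2) \<le> e\<^sup>2"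
    if e: "e > 0" for e
  proof -
    obtain N where N: "\<And>m n. m \<ge> N \<Longrightarrow> n \<ge> N \<Longrightarrow> norm (X n - X m) < e"
      using X e unfolding Cauchy_def dist_norm by metis
    have "(\<Sum>i\<in>F. (cmod (coord (X n) i - f i))\<^sup>2) \<le> e\<^sup>2" if n: "n \<ge> N" and F: "finite F" for n F
    proof (rule LIMSEQ_le_const2)
      show "(\<lambda>m. \<Sum>i\<in>F. (cmod (coord (X n) i - coord (X m) i))\<^sup>2)
          \<longlonglongrightarrow> (\<Sum>i\<in>F. (cmod (coord (X n) i - f i))\<^sup>2)"
        by (intro tendsto_intros f)
      have "(\<Sum>i\<in>F. (cmod (coord (X n) i - coord (X m) i))\<^sup>2) \<le> e\<^sup>2" if "m \<ge> N" for m
      proof -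
        have "(norm (X n - X m))\<^sup>2 \<le> e\<^sup>2" using N[OF that n] by (intro power_mono) auto
        with sum_coord_le_norm[OF F, of "X n - X m"] show ?thesis by (simp add: minus_ell2.rep_eq)
      qed
      then show "\<exists>M. \<forall>m\<ge>M. (\<Sum>i\<in>F. (cmod (coord (X n) i - coord (X m) i))\<^sup>2) \<le> e\<^sup>2" by blast
    qed
    then show ?thesis by blast
  qed
  have "(\<lambda>i. (cmod (f i))\<^sup>2) summable_on UNIV"
  proof -
    obtain n where n: "\<And>F. finite F \<Longrightarrow> (\<Sum>i\<in>F. (cmod (coord (X n) i - f i))\<^sup>2) \<le> 1"
      using tail[of 1] by auto
    have "(\<lambda>i. (cmod (coord (X n) i - f i))\<^sup>2) summable_on UNIV"
      by (rule nonneg_bdd_above_summable_on) (auto intro!: bdd_aboveI[where M = 1] n)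
    then have "(\<lambda>i. (cmod (f i - coord (X n) i))\<^sup>2) summable_on UNIV"
      by (simp add: norm_minus_commute)
    from sq_summable_add[OF this coord_summable[of "X n"]] show ?thesis by simp
  qed
  then have Y: "coord (Abs_ell2 f) = f" by (simp add: Abs_ell2_inverse)
  have "X \<longlonglongrightarrow> Abs_ell2 f"
  proof (rule LIMSEQ_I)
    fix r :: real assume r: "0 < r"
    then obtain N where N: "\<And>n F. n \<ge> N \<Longrightarrow> finite F \<Longrightarrow>
        (\<Sum>i\<in>F. (cmod (coord (X n) i - f i))\<^sup>2) \<le> (r / 2)\<^sup>2"
      using tail[of "r / 2"] by auto
    have "norm (X n - Abs_ell2 f) \<le> r / 2" if "n \<ge> N" for n
      by (rule norm_le_if_sum_coord_le) (use N[OF that] r in \<open>auto simp: minus_ell2.rep_eq Y\<close>)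
    then show "\<exists>N. \<forall>n\<ge>N. norm (X n - Abs_ell2 f) < r" using r by (intro exI[of _ N]) fastforce
  qed
  then show "convergent X" by (auto simp: convergent_def)
qed

lemma cscale_cscale: "a *\<^sub>C b *\<^sub>C x = (a * b) *\<^sub>C x"
  by (rule ell2_eqI) (simp add: cscale.rep_eq)

lemma cscale_add_left: "(a + b) *\<^sub>C x = a *\<^sub>C x + b *\<^sub>C x"
  by (rule ell2_eqI) (simp add: cscale.rep_eq plus_ell2.rep_eq ring_distribs)

lemma cscale_minus_one: "(-1) *\<^sub>C x = - x"
  by (rule ell2_eqI) (simp add: cscale.rep_eq uminus_ell2.rep_eq)

lemma cscale_Re_Im: "c *\<^sub>C x = Re c *\<^sub>R x + Im c *\<^sub>R (\<i> *\<^sub>C x)"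
proof -
  have "c = of_real (Re c) + of_real (Im c) * \<i>" by (simp add: complex_eq_iff)
  then have "c *\<^sub>C x = (of_real (Re c) + of_real (Im c) * \<i>) *\<^sub>C x" by metis
  then show ?thesis
    unfolding cscale_add_left cscale_cscale[symmetric] cscale_complex_of_real .
qed

lemma inner_cscale_right: "inner x (c *\<^sub>C y) = inner (cnj c *\<^sub>C x) y"
  by (simp add: inner_ell2_def cscale.rep_eq inner_complex_def algebra_simps)

text \<open>Projections and extensions are carried out with the real inner product. This formula
  returns to the complex one: a real isometry that commutes with \<i> preserves
  \<open>cinner\<close>.\<close>

lemma cinner_conv_inner: "cinner x y = Complex (inner x y) (inner (\<i> *\<^sub>C x) y)"
proof (rule complex_eqI)
  have *: "cnj (coord x i) * coord y i =
      of_real (inner (coord x i) (coord y i)) + \<i> * of_real (inner (coord (\<i> *\<^sub>C x) i) (coord y i))" for i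
    by (simp add: complex_eq_iff inner_complex_def cscale.rep_eq)
  have "((\<lambda>i. complex_of_real (inner (coord z i) (coord y i))) has_sum of_real (inner z y)) UNIV" for z
    unfolding inner_ell2_def by (intro has_sum_of_real has_sum_infsum inner_summable)
  from has_sum_add[OF this has_sum_cmult_right[OF this]]
  have "cinner x y = of_real (inner x y) + \<i> * of_real (inner (\<i> *\<^sub>C x) y)"
    unfolding cinner_def * by (rule infsumI)
  then show "Re (cinner x y) = Re (Complex (inner x y) (inner (\<i> *\<^sub>C x) y))"
    "Im (cinner x y) = Im (Complex (inner x y) (inner (\<i> *\<^sub>C x) y))" by simp_all
qed

section \<open>Closed spans, bounded extensions and orthogonal projections\<close>

lemma subspace_closure:
  fixes S :: "'a::real_normed_vector set"
  assumes "subspace S"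
  shows "subspace (closure S)"
proof (rule subspaceI)
  show "0 \<in> closure S" using subspace_0[OF assms] closure_subset by blast
  show "x + y \<in> closure S" if xy: "x \<in> closure S" "y \<in> closure S" for x y
  proof -
    obtain X Y where "\<And>n. X n \<in> S" "X \<longlonglongrightarrow> x" "\<And>n. Y n \<in> S" "Y \<longlonglongrightarrow> y"
      using xy unfolding closure_sequential by metis
    then show ?thesis unfolding closure_sequential
      by (intro exI[of _ "\<lambda>n. X n + Y n"]) (auto intro: tendsto_add subspace_add[OF assms])
  qed
  show "c *\<^sub>R x \<in> closure S" if x: "x \<in> closure S" for c x
  proof -
    obtain X where "\<And>n. X n \<in> S" "X \<longlonglongrightarrow> x"
      using x unfolding closure_sequential by metis
    then show ?thesis unfolding closure_sequential
      by (intro exI[of _ "\<lambda>n. c *\<^sub>R X n"]) (auto intro: tendsto_scaleR subspace_scale[OF assms])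
  qed
qed

lemma closure_span_minimal:
  fixes S :: "'a::real_normed_vector set"
  assumes "B \<subseteq> S" "subspace S" "closed S"
  shows "closure (span B) \<subseteq> S"
  by (intro closure_minimal span_minimal assms)

text \<open>The difference \<open>x - y\<close> lies in the closed span and is orthogonal to it,
  hence to itself.\<close>

lemma eq_if_inner_eq_on_spanning_set:
  fixes x y :: "'a::real_inner"
  assumes "x \<in> closure (span B)" "y \<in> closure (span B)" "\<And>w. w \<in> B \<Longrightarrow> inner w x = inner w y"
  shows "x = y"
proof -
  have "x - y \<in> closure (span B)"
    using assms subspace_diff[OF subspace_closure[OF subspace_span]] by blast
  also have "closure (span B) \<subseteq> {w. inner w (x - y) = 0}"
    using assms(3)
    by (intro closure_span_minimal subspaceI closed_Collect_eq continuous_intros)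
      (auto simp: inner_add_left inner_diff_right)
  finally show ?thesis by simp
qed

text \<open>\<open>R\<close> is the graph of a bounded operator on a subspace and \<open>f\<close> its continuous extension.\<close>

lemma closure_graph_bounded:
  fixes R :: "('a::banach \<times> 'b::banach) set"
  assumes R: "subspace R" and bound: "\<And>p. p \<in> R \<Longrightarrow> norm (snd p) \<le> C * norm (fst p)"
  obtains f where "\<And>x y. x \<in> closure (fst ` R) \<Longrightarrow> (x, y) \<in> closure R \<longleftrightarrow> y = f x"
proof -
  let ?S = "closure R"
  have S: "subspace ?S" by (rule subspace_closure[OF R])
  have "?S \<subseteq> {p. norm (snd p) \<le> C * norm (fst p)}"
    using bound by (intro closure_minimal closed_Collect_le continuous_intros) auto
  then have bound': "norm (snd p) \<le> C * norm (fst p)" if "p \<in> ?S" for p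
    using that by blast
  \<comment> \<open>On the closed graph \<open>fst\<close> is bounded below. Its image is therefore
    complete, hence closed, and contains the closure of the original domain.\<close>
  have *: "1 / (1 + \<bar>C\<bar>) * norm p \<le> norm (fst p)" if "p \<in> ?S" for p
  proof -
    have "norm p \<le> norm (fst p) + norm (snd p)" using norm_Pair_le[of "fst p" "snd p"] by simp
    also have "norm (snd p) \<le> \<bar>C\<bar> * norm (fst p)"
      using bound'[OF that] by (meson abs_ge_self mult_right_mono norm_ge_zero order_trans)
    finally show ?thesis by (simp add: field_simps)
  qed
  have "complete (fst ` ?S)"
    by (rule complete_isometric_image[of "1 / (1 + \<bar>C\<bar>)"])
      (use * S in \<open>auto simp: bounded_linear_fst complete_eq_closed\<close>)
  then have "closed (fst ` ?S)" by (rule complete_imp_closed)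
  then have "closure (fst ` R) \<subseteq> fst ` ?S"
    using closure_subset[of R] by (intro closure_minimal) auto
  then have "\<exists>y. (x, y) \<in> ?S" if "x \<in> closure (fst ` R)" for x
    using that by force
  moreover have "y = z" if "(x, y) \<in> ?S" "(x, z) \<in> ?S" for x y z
    using bound'[OF subspace_diff[OF S that]] by simp
  ultimately show ?thesis
    by (intro that[of "\<lambda>x. SOME y. (x, y) \<in> ?S"]) (metis someI_ex)
qed

text \<open>Equal Gram matrices force equal norms on the span of the pairs
  \<open>(W i, W' i)\<close>. This makes the span a graph and settles well-definedness on all linear
  combinations at once.\<close>

lemma isometry_extension:
  fixes W W' :: "'i \<Rightarrow> 'a::{real_inner,banach}"
  assumes gram: "\<And>i j. inner (W i) (W j) = inner (W' i) (W' j)"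
  obtains U where
    "\<And>x. x \<in> closure (span (range W)) \<Longrightarrow> U x \<in> closure (span (range W'))"
    "\<And>x i. x \<in> closure (span (range W)) \<Longrightarrow> inner (W' i) (U x) = inner (W i) x"
    "\<And>x y. x \<in> closure (span (range W)) \<Longrightarrow> y \<in> closure (span (range W)) \<Longrightarrow> inner (U x) (U y) = inner x y"
proof -
  define B where "B = range (\<lambda>i. (W i, W' i))"
  let ?S = "closure (span B)"
  \<comment> \<open>The identity is linear and closed in each argument, so it passes from generators
    to the closed span one argument at a time.\<close>
  have "?S \<subseteq> {q. inner (fst p) (fst q) = inner (snd p) (snd q)}" if "p \<in> B" for p
    using that gram unfolding B_def
    by (intro closure_span_minimal subspaceI closed_Collect_eq continuous_intros)
      (auto simp: inner_add_right)
  then have *: "B \<subseteq> {p. inner (fst p) (fst q) = inner (snd p) (snd q)}" if "q \<in> ?S" for q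
    using that by blast
  have "?S \<subseteq> {p. inner (fst p) (fst q) = inner (snd p) (snd q)}" if "q \<in> ?S" for q
    by (intro closure_span_minimal subspaceI closed_Collect_eq continuous_intros *[OF that])
      (auto simp: inner_add_left)
  then have iso: "inner (fst p) (fst q) = inner (snd p) (snd q)" if "p \<in> ?S" "q \<in> ?S" for p q
    using that by blast
  have "norm (snd p) \<le> 1 * norm (fst p)" if "p \<in> span B" for p
    using iso[of p p] that closure_subset[of "span B"] by (auto simp: norm_eq_sqrt_inner)
  from closure_graph_bounded[OF subspace_span this]
  obtain U where U: "\<And>x y. x \<in> closure (fst ` span B) \<Longrightarrow> (x, y) \<in> ?S \<longleftrightarrow> y = U x" by blast
  have "fst ` span B = span (range W)"
    using span_linear_image[OF linear_fst, of B] by (simp add: B_def image_image)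
  with U have US: "(x, U x) \<in> ?S" if "x \<in> closure (span (range W))" for x
    using that by auto
  have W: "(W i, W' i) \<in> ?S" for i
    using closure_subset[of "span B"] span_superset[of B] by (auto simp: B_def)
  have "snd ` span B = span (range W')"
    using span_linear_image[OF linear_snd, of B] by (simp add: B_def image_image)
  moreover have "snd ` ?S \<subseteq> closure (snd ` span B)"
    by (intro continuous_image_closure_subset[of UNIV] continuous_intros) auto
  ultimately have US': "U x \<in> closure (span (range W'))" if "x \<in> closure (span (range W))" for x
    using US[OF that] by force
  show ?thesis
  proof (rule that[OF US'])
    show "inner (W' i) (U x) = inner (W i) x" if "x \<in> closure (span (range W))" for x i
      using iso[OF W[of i] US[OF that]] by simp
    show "inner (U x) (U y) = inner x y"
      if "x \<in> closure (span (range W))" "y \<in> closure (span (range W))" for x y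
      using iso[OF US[OF that(1)] US[OF that(2)]] by simp
  qed
qed

lemma orthogonal_projection_exists:
  fixes S :: "'a::{real_inner,banach} set"
  assumes S: "subspace S" "closed S"
  obtains p where "p \<in> S" "\<And>s. s \<in> S \<Longrightarrow> inner s (x - p) = 0"
proof -
  define D where "D = (\<lambda>s. (norm (x - s))\<^sup>2) ` S"
  have D: "D \<noteq> {}" "bdd_below D"
    using subspace_0[OF S(1)] by (auto simp: D_def intro!: bdd_belowI[of _ 0])
  define m where "m = Inf D"
  have m: "m \<le> (norm (x - s))\<^sup>2" if "s \<in> S" for s
    unfolding m_def by (rule cInf_lower) (use that D in \<open>auto simp: D_def\<close>)
  have "\<exists>s\<in>S. (norm (x - s))\<^sup>2 < m + 1 / Suc n" for n
    using cInf_lessD[OF D(1), of "m + 1 / Suc n"] by (auto simp: m_def D_def)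
  then obtain s where s: "\<And>n. s n \<in> S" "\<And>n. (norm (x - s n))\<^sup>2 < m + 1 / Suc n" by metis
  \<comment> \<open>Parallelogram law: the midpoint of \<open>s k\<close> and \<open>s n\<close>
    lies in \<open>S\<close>, so its squared distance from \<open>x\<close> is at least
    \<open>m\<close>.\<close>
  have close: "(norm (s k - s n))\<^sup>2 \<le> 2 / Suc k + 2 / Suc n" for k n
  proof -
    have "(1/2) *\<^sub>R (s k + s n) \<in> S" by (intro subspace_scale subspace_add S s)
    from m[OF this] have "4 * m \<le> 4 * (norm (x - (1/2) *\<^sub>R (s k + s n)))\<^sup>2" by simp
    moreover have "(norm (s k - s n))\<^sup>2 = 2 * (norm (x - s k))\<^sup>2 + 2 * (norm (x - s n))\<^sup>2
        - 4 * (norm (x - (1/2) *\<^sub>R (s k + s n)))\<^sup>2"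
      by (simp add: power2_norm_eq_inner inner_diff_left inner_diff_right inner_add_left
          inner_add_right inner_commute algebra_simps)
    ultimately show ?thesis using s(2)[of k] s(2)[of n] by simp
  qed
  have "Cauchy s"
  proof (rule CauchyI)
    fix e :: real assume e: "0 < e"
    obtain N where N: "4 / e\<^sup>2 < real (Suc N)"
      by (metis reals_Archimedean2 less_SucI of_nat_less_iff order_less_trans lessI)
    have "norm (s k - s n) < e" if "k \<ge> N" "n \<ge> N" for k n
    proof -
      have "2 / real (Suc k) + 2 / real (Suc n) \<le> 2 / Suc N + 2 / Suc N"
        using that by (intro add_mono divide_left_mono) auto
      also have "\<dots> = 4 / Suc N" by simp
      also have "\<dots> < e\<^sup>2" using N e by (simp only: divide_less_eq) (simp add: field_simps)
      finally have "(norm (s k - s n))\<^sup>2 < e\<^sup>2" using close[of k n] by linarith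
      then show ?thesis using e by (simp add: power_less_imp_less_base)
    qed
    then show "\<exists>M. \<forall>m\<ge>M. \<forall>n\<ge>M. norm (s m - s n) < e" by blast
  qed
  then obtain p where p: "s \<longlonglongrightarrow> p" using Cauchy_convergent convergent_def by blast
  have pS: "p \<in> S" using closed_sequentially[OF S(2)] s(1) p by blast
  have "(norm (x - p))\<^sup>2 \<le> m"
  proof (rule LIMSEQ_le)
    show "(\<lambda>n. (norm (x - s n))\<^sup>2) \<longlonglongrightarrow> (norm (x - p))\<^sup>2" by (intro tendsto_intros p)
    have "(\<lambda>n. 1 / real (Suc n)) \<longlonglongrightarrow> 0" using LIMSEQ_inverse_real_of_nat by (simp add: inverse_eq_divide)
    from tendsto_add[OF tendsto_const this] show "(\<lambda>n. m + 1 / real (Suc n)) \<longlonglongrightarrow> m" by simp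
  qed (use s(2) in \<open>auto intro: less_imp_le\<close>)
  with m have min: "(norm (x - p))\<^sup>2 \<le> (norm (x - s))\<^sup>2" if "s \<in> S" for s
    using that order_trans by blast
  have "inner s (x - p) = 0" if "s \<in> S" for s
  proof (cases "s = 0")
    case False
    \<comment> \<open>The minimiser of the distance from \<open>x\<close> along the line through
      \<open>p\<close> in direction \<open>s\<close>. Minimality at \<open>p\<close> forces the
      inner product to vanish.\<close>
    define r where "r = inner s (x - p) / inner s s"
    have "p + r *\<^sub>R s \<in> S" by (intro subspace_add subspace_scale S pS that)
    from min[OF this] have "inner (x - p) (x - p) \<le> inner ((x - p) - r *\<^sub>R s) ((x - p) - r *\<^sub>R s)"
      by (simp add: power2_norm_eq_inner algebra_simps)
    also have "\<dots> = inner (x - p) (x - p) - 2 * r * inner s (x - p) + r * r * inner s s"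
      by (simp only: inner_diff_left inner_diff_right inner_scaleR_left inner_scaleR_right
          inner_commute[of x s] inner_commute[of p s] inner_commute[of p x]) (simp add: algebra_simps)
    also have "r * r * inner s s = r * inner s (x - p)" using False by (simp add: r_def)
    finally have "r * inner s (x - p) \<le> 0" by simp
    then have "(inner s (x - p))\<^sup>2 / inner s s \<le> 0" by (simp add: r_def power2_eq_square)
    moreover have "inner s s > 0" using False by simp
    ultimately show ?thesis by (simp add: divide_le_0_iff)
  qed simp
  with pS show ?thesis by (rule that)
qed

section \<open>Unitary representations\<close>

lemma unitary_rep_subspace:
  assumes "unitary_rep H \<pi>"
  shows "subspace H"
proof (rule subspaceI)
  show "c *\<^sub>R \<xi> \<in> H" if "\<xi> \<in> H" for c \<xi>
    using assms that unfolding unitary_rep_def cscale_complex_of_real[symmetric] by blast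
qed (use assms in \<open>auto simp: unitary_rep_def\<close>)

lemma unitary_rep_diff:
  assumes "unitary_rep H \<pi>" "\<xi> \<in> H" "\<eta> \<in> H"
  shows "\<pi> g (\<xi> - \<eta>) = \<pi> g \<xi> - \<pi> g \<eta>"
proof -
  have "\<pi> g (\<xi> + (-1) *\<^sub>C \<eta>) = \<pi> g \<xi> + (-1) *\<^sub>C \<pi> g \<eta>"
    using assms unfolding unitary_rep_def by simp
  then show ?thesis by (simp add: cscale_minus_one)
qed

lemma unitary_rep_inner:
  assumes "unitary_rep H \<pi>" "\<xi> \<in> H" "\<eta> \<in> H"
  shows "inner (\<pi> g \<xi>) (\<pi> g \<eta>) = inner \<xi> \<eta>"
proof -
  have "cinner (\<pi> g \<xi>) (\<pi> g \<eta>) = cinner \<xi> \<eta>"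
    using assms unfolding unitary_rep_def by blast
  then show ?thesis by (simp add: cinner_conv_inner)
qed

lemma unitary_rep_norm:
  assumes "unitary_rep H \<pi>" "\<xi> \<in> H"
  shows "norm (\<pi> g \<xi>) = norm \<xi>"
  using unitary_rep_inner[OF assms assms(2)] by (simp add: norm_eq_sqrt_inner)

lemma unitary_rep_restrict:
  assumes \<pi>: "unitary_rep H \<pi>" and sub: "H' \<subseteq> H" and "closed H'" "0 \<in> H'"
    "\<And>\<xi> \<eta>. \<xi> \<in> H' \<Longrightarrow> \<eta> \<in> H' \<Longrightarrow> \<xi> + \<eta> \<in> H'" "\<And>c \<xi>. \<xi> \<in> H' \<Longrightarrow> c *\<^sub>C \<xi> \<in> H'"
    "\<And>g \<xi>. \<xi> \<in> H' \<Longrightarrow> \<pi> g \<xi> \<in> H'"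
  shows "unitary_rep H' \<pi>"
  unfolding unitary_rep_def
proof (intro conjI ballI allI)
  fix g h c \<xi> assume "\<xi> \<in> H'"
  then have \<xi>: "\<xi> \<in> H" using sub by blast
  then show "\<pi> g (c *\<^sub>C \<xi>) = c *\<^sub>C \<pi> g \<xi>" "\<pi> 0 \<xi> = \<xi>" "\<pi> (g + h) \<xi> = \<pi> g (\<pi> h \<xi>)"
    using \<pi> unfolding unitary_rep_def by blast+
  fix \<eta> assume "\<eta> \<in> H'"
  then have "\<eta> \<in> H" using sub by blast
  with \<xi> show "\<pi> g (\<xi> + \<eta>) = \<pi> g \<xi> + \<pi> g \<eta>" "cinner (\<pi> g \<xi>) (\<pi> g \<eta>) = cinner \<xi> \<eta>"
    using \<pi> unfolding unitary_rep_def by blast+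
qed (use assms in auto)

lemma unitary_rep_invariants:
  fixes \<pi> :: "'g::group_add \<Rightarrow> nat ell2 \<Rightarrow> nat ell2"
  assumes \<pi>: "unitary_rep H \<pi>"
  defines "I \<equiv> {\<xi>\<in>H. \<forall>g. \<pi> g \<xi> = \<xi>}"
  shows "closed I" "subspace I" "\<xi> \<in> I \<Longrightarrow> c *\<^sub>C \<xi> \<in> I"
proof -
  show cI: "c *\<^sub>C \<xi> \<in> I" if "\<xi> \<in> I" for c \<xi>
    using that \<pi> unfolding I_def unitary_rep_def by simp
  show "subspace I"
  proof (rule subspaceI)
    have "\<pi> g 0 = 0" for g
      using unitary_rep_norm[OF \<pi> subspace_0[OF unitary_rep_subspace[OF \<pi>]], of g] by simp
    then show "0 \<in> I" using \<pi> by (simp add: I_def unitary_rep_def)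
    show "x + y \<in> I" if "x \<in> I" "y \<in> I" for x y
      using that \<pi> unfolding I_def unitary_rep_def by simp
    show "c *\<^sub>R x \<in> I" if "x \<in> I" for c x
      using cI[OF that, of "of_real c"] by (simp add: cscale_complex_of_real)
  qed
  show "closed I"
    unfolding closed_sequential_limits
  proof safe
    fix X \<xi> assume X: "\<forall>n. X n \<in> I" "X \<longlonglongrightarrow> \<xi>"
    have "closed H" using \<pi> by (simp add: unitary_rep_def)
    then have \<xi>: "\<xi> \<in> H" using X closed_sequentially unfolding I_def by blast
    have "\<pi> g \<xi> = \<xi>" for g
    proof (rule LIMSEQ_unique)
      \<comment> \<open>Each \<open>X n\<close> is fixed by an isometry, hence equally far from
        \<open>\<xi>\<close> and \<open>\<pi> g \<xi>\<close>; the sequence then converges to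
        both.\<close>
      have "norm (\<pi> g \<xi> - X n) = norm (\<xi> - X n)" for n
        using X(1) unitary_rep_diff[OF \<pi> \<xi>, of "X n" g] unitary_rep_norm[OF \<pi>, of "\<xi> - X n" g]
          subspace_diff[OF unitary_rep_subspace[OF \<pi>] \<xi>, of "X n"]
        by (auto simp: I_def)
      then have "dist (X n) (\<pi> g \<xi>) = dist (X n) \<xi>" for n
        by (metis dist_norm dist_commute)
      then show "X \<longlonglongrightarrow> \<pi> g \<xi>"
        using X(2) unfolding tendsto_iff by simp
    qed (rule X(2))
    with \<xi> show "\<xi> \<in> I" by (simp add: I_def)
  qed
qed

text \<open>Apply the Kazhdan pair to the orthogonal complement of the invariant vectors.\<close>

lemma property_T_almost_invariant:
  assumes "property_T TYPE('g::group_add)"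
  obtains K :: "'g::group_add set" and \<epsilon> where "finite K" "\<epsilon> > 0"
    "\<And>H (\<pi> :: 'g::group_add \<Rightarrow> nat ell2 \<Rightarrow> nat ell2) \<xi> \<delta> g. unitary_rep H \<pi> \<Longrightarrow> \<xi> \<in> H \<Longrightarrow> 0 < \<delta> \<Longrightarrow>
      (\<And>k. k \<in> K \<Longrightarrow> norm (\<pi> k \<xi> - \<xi>) < \<epsilon> * \<delta>) \<Longrightarrow> norm (\<pi> g \<xi> - \<xi>) \<le> 2 * \<delta>"
proof -
  obtain K :: "'g set" and \<epsilon> where K: "finite K" "\<epsilon> > 0" and
    T: "\<And>H (\<pi> :: 'g \<Rightarrow> nat ell2 \<Rightarrow> nat ell2). unitary_rep H \<pi> \<Longrightarrow>
        (\<exists>\<xi>\<in>H. \<xi> \<noteq> 0 \<and> (\<forall>g\<in>K. norm (\<pi> g \<xi> - \<xi>) < \<epsilon> * norm \<xi>)) \<Longrightarrow>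
        (\<exists>\<xi>\<in>H. \<xi> \<noteq> 0 \<and> (\<forall>g. \<pi> g \<xi> = \<xi>))"
    using assms unfolding property_T_def by metis
  show ?thesis
  proof (rule that[OF K])
    fix H and \<pi> :: "'g \<Rightarrow> nat ell2 \<Rightarrow> nat ell2" and \<xi> \<delta> g
    assume \<pi>: "unitary_rep H \<pi>" and \<xi>: "\<xi> \<in> H" and \<delta>: "0 < \<delta>"
      and small: "\<And>k. k \<in> K \<Longrightarrow> norm (\<pi> k \<xi> - \<xi>) < \<epsilon> * \<delta>"
    define I where "I = {\<xi>\<in>H. \<forall>g. \<pi> g \<xi> = \<xi>}"
    note I = unitary_rep_invariants[OF \<pi>, folded I_def]
    \<comment> \<open>Real orthogonality gives a complex subspace here, because \<open>I\<close> is
      stable under complex scalars.\<close>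
    define H' where "H' = {\<zeta>\<in>H. \<forall>\<eta>\<in>I. inner \<eta> \<zeta> = 0}"
    obtain p where p: "p \<in> I" "\<And>\<eta>. \<eta> \<in> I \<Longrightarrow> inner \<eta> (\<xi> - p) = 0"
      using orthogonal_projection_exists[OF I(2,1)] by blast
    define q where "q = \<xi> - p"
    have qH: "q \<in> H"
      using subspace_diff[OF unitary_rep_subspace[OF \<pi>] \<xi>] p(1) by (simp add: q_def I_def)
    then have q: "q \<in> H'" using p(2) by (simp add: q_def H'_def)
    have \<pi>q: "\<pi> k q - q = \<pi> k \<xi> - \<xi>" for k
      using unitary_rep_diff[OF \<pi> \<xi>, of p k] p(1) by (simp add: q_def I_def)
    have "unitary_rep H' \<pi>"
    proof -
      have "H' = H \<inter> (\<Inter>\<eta>\<in>I. {\<zeta>. inner \<eta> \<zeta> = 0})" by (auto simp: H'_def)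
      moreover have "closed H" using \<pi> by (simp add: unitary_rep_def)
      ultimately have "closed H'"
        by (auto intro!: closed_Int closed_INT closed_Collect_eq continuous_intros)
      moreover have "c *\<^sub>C \<zeta> \<in> H'" if "\<zeta> \<in> H'" for c \<zeta>
        using that \<pi> I(3) by (auto simp: H'_def inner_cscale_right unitary_rep_def)
      moreover have "\<pi> k \<zeta> \<in> H'" if "\<zeta> \<in> H'" for k \<zeta>
      proof -
        have "inner \<eta> (\<pi> k \<zeta>) = 0" if "\<eta> \<in> I" for \<eta>
          using unitary_rep_inner[OF \<pi>, of \<eta> \<zeta> k] that \<open>\<zeta> \<in> H'\<close> by (simp add: I_def H'_def)
        then show ?thesis using that \<pi> by (simp add: H'_def unitary_rep_def)
      qed
      moreover have "0 \<in> H'" "\<And>\<zeta> \<eta>. \<zeta> \<in> H' \<Longrightarrow> \<eta> \<in> H' \<Longrightarrow> \<zeta> + \<eta> \<in> H'"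
        using \<pi> by (auto simp: H'_def inner_add_right unitary_rep_def)
      moreover have "H' \<subseteq> H" by (auto simp: H'_def)
      ultimately show ?thesis
        by (intro unitary_rep_restrict[OF \<pi>])
    qed
    from T[OF this] have "q = 0 \<or> (\<exists>\<zeta>\<in>H'. \<zeta> \<noteq> 0 \<and> (\<forall>g. \<pi> g \<zeta> = \<zeta>))"
      if "\<forall>k\<in>K. norm (\<pi> k q - q) < \<epsilon> * norm q"
      using that q by blast
    moreover have "\<not> (\<exists>\<zeta>\<in>H'. \<zeta> \<noteq> 0 \<and> (\<forall>g. \<pi> g \<zeta> = \<zeta>))"
    proof safe
      fix \<zeta> assume "\<zeta> \<in> H'" "\<zeta> \<noteq> 0" "\<forall>g. \<pi> g \<zeta> = \<zeta>"
      then have "inner \<zeta> \<zeta> = 0" by (simp add: H'_def I_def)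
      with \<open>\<zeta> \<noteq> 0\<close> show False by simp
    qed
    ultimately have "q = 0 \<or> (\<exists>k\<in>K. \<epsilon> * norm q \<le> norm (\<pi> k q - q))"
      using not_le by blast
    \<comment> \<open>A nonzero \<open>q\<close> is moved by some \<open>k\<close> in
      \<open>K\<close> by at least \<open>\<epsilon> * norm q\<close>, and \<open>\<xi>\<close> is
      displaced by the same vector. This bounds \<open>q\<close>, and an isometry displaces
      \<open>q\<close> by at most twice its norm.\<close>
    then have "norm q \<le> \<delta>"
    proof
      assume "\<exists>k\<in>K. \<epsilon> * norm q \<le> norm (\<pi> k q - q)"
      then obtain k where "k \<in> K" "\<epsilon> * norm q \<le> norm (\<pi> k \<xi> - \<xi>)" by (auto simp: \<pi>q)
      with small[of k] have "\<epsilon> * norm q \<le> \<epsilon> * \<delta>" by linarith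
      then show ?thesis using K by simp
    qed (use \<delta> in simp)
    moreover have "norm (\<pi> g \<xi> - \<xi>) \<le> norm (\<pi> g q) + norm q"
      unfolding \<pi>q[symmetric] by (rule norm_triangle_ineq4)
    ultimately show "norm (\<pi> g \<xi> - \<xi>) \<le> 2 * \<delta>"
      using unitary_rep_norm[OF \<pi> qH, of g] by simp
  qed
qed

section \<open>The GNS representation of an invariant kernel\<close>

text \<open>Invariance of \<open>A\<close> says that left translation of the indices preserves the
  Gram matrix, so it extends to isometries of the closed span. The displacement formula expands the
  norm, with \<open>A g g = A 0 0\<close>.\<close>

lemma gns_construction:
  fixes A :: "'g::group_add \<Rightarrow> 'g \<Rightarrow> real"
  assumes "countable (UNIV :: 'g set)" and A: "psd A"
    and inv: "\<And>k g h. A (k + g) (k + h) = A g h"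
  obtains H \<pi> \<xi> where "unitary_rep H \<pi>" "\<xi> \<in> H"
    "\<And>g. (norm (\<pi> g \<xi> - \<xi>))\<^sup>2 = 2 * A 0 0 - 2 * A g 0"
proof -
  obtain u :: "'g \<Rightarrow> nat \<Rightarrow> real" and N where
    u: "\<And>x k. N x \<le> k \<Longrightarrow> u x k = 0" "\<And>x y n. N x \<le> n \<Longrightarrow> (\<Sum>k<n. u x k * u y k) = A x y"
    using psd_gram_countable[OF A assms(1)] by metis
  define V where "V g = Abs_ell2 (\<lambda>i. complex_of_real (u g i))" for g
  have V: "coord (V g) i = of_real (u g i)" for g i
  proof -
    have "finite {i. u g i \<noteq> 0}"
      by (rule finite_subset[of _ "{..<N g}"]) (use u(1) in \<open>auto simp: not_le[symmetric]\<close>)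
    then have "(\<lambda>i. (cmod (complex_of_real (u g i)))\<^sup>2) summable_on UNIV"
      by (intro finite_nonzero_values_imp_summable_on) simp
    then show ?thesis by (simp add: V_def Abs_ell2_inverse)
  qed
  have VV: "inner (V g) (V h) = A g h" for g h
  proof -
    have "inner (V g) (V h) = (\<Sum>\<^sub>\<infinity>i. u g i * u h i)"
      by (simp add: inner_ell2_def V inner_complex_def)
    also have "\<dots> = (\<Sum>\<^sub>\<infinity>i\<in>{..<N g}. u g i * u h i)"
      by (rule infsum_cong_neutral) (use u(1) in \<open>auto simp: not_less\<close>)
    also have "\<dots> = A g h" using u(2)[of g "N g" h] by simp
    finally show ?thesis .
  qed
  have iV: "inner (\<i> *\<^sub>C V g) (V h) = 0" for g h
    by (simp add: inner_ell2_def V inner_complex_def cscale.rep_eq)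
  \<comment> \<open>Adjoining the multiples by \<i> makes the closed real span a complex subspace.
    The coordinates of \<open>V\<close> are real, so the enlarged Gram matrix consists of two
    orthogonal copies of \<open>A\<close>.\<close>
  define W where "W = (\<lambda>(g, b). if b then \<i> *\<^sub>C V g else V g)"
  have W: "inner (W (g, a)) (W (h, b)) = (if a = b then A g h else 0)" for g h a b
  proof -
    have "inner (\<i> *\<^sub>C V g) (\<i> *\<^sub>C V h) = A g h"
      using cscale_complex_of_real[of 1 "V g"] by (simp add: inner_cscale_right cscale_cscale VV)
    moreover have "inner (V g) (\<i> *\<^sub>C V h) = 0" using iV[of h g] by (simp add: inner_commute)
    ultimately show ?thesis using VV[of g h] iV[of g h] by (simp add: W_def)
  qed
  define W' where "W' k = (\<lambda>(g, b). W (k + g, b))" for k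
  define H where "H = closure (span (range W))"
  have rangeW': "range (W' k) = range W" for k
  proof -
    have "range (\<lambda>(g, b :: bool). (k + g, b)) = UNIV"
      by (rule surjI[of _ "\<lambda>(g, b). (- k + g, b)"]) (auto simp: add.assoc[symmetric])
    moreover have "W' k = W \<circ> (\<lambda>(g, b). (k + g, b))" by (auto simp: W'_def)
    ultimately show ?thesis by (simp only: image_comp[symmetric])
  qed
  have gram: "inner (W i) (W j) = inner (W' k i) (W' k j)" for i j k
    by (cases i; cases j) (simp add: W'_def W inv)
  have "\<exists>U. (\<forall>x\<in>H. U x \<in> H) \<and> (\<forall>x\<in>H. \<forall>i. inner (W' k i) (U x) = inner (W i) x)
      \<and> (\<forall>x\<in>H. \<forall>y\<in>H. inner (U x) (U y) = inner x y)" for k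
  proof -
    note iso_ext = isometry_extension[of W "W' k", OF gram, unfolded rangeW' H_def[symmetric]]
    show ?thesis
    proof (rule iso_ext)
      fix U assume "\<And>x. x \<in> H \<Longrightarrow> U x \<in> H" "\<And>x i. x \<in> H \<Longrightarrow> inner (W' k i) (U x) = inner (W i) x"
        "\<And>x y. x \<in> H \<Longrightarrow> y \<in> H \<Longrightarrow> inner (U x) (U y) = inner x y"
      then show ?thesis by (intro exI[of _ U]) simp
    qed
  qed
  then obtain \<pi> where \<pi>H: "\<And>k x. x \<in> H \<Longrightarrow> \<pi> k x \<in> H"
    and \<pi>W: "\<And>k x i. x \<in> H \<Longrightarrow> inner (W' k i) (\<pi> k x) = inner (W i) x"
    and \<pi>inner: "\<And>k x y. x \<in> H \<Longrightarrow> y \<in> H \<Longrightarrow> inner (\<pi> k x) (\<pi> k y) = inner x y"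
    by metis
  \<comment> \<open>Uniqueness principle: a vector of \<open>H\<close> is determined by its inner
    products with the translated generators. Additivity, complex homogeneity and the homomorphism
    law are all read off from it.\<close>
  have \<pi>I: "y = \<pi> k x" if xy: "x \<in> H" "y \<in> H" "\<And>g b. inner (W (k + g, b)) y = inner (W (g, b)) x" for x y k
  proof (rule eq_if_inner_eq_on_spanning_set)
    show "y \<in> closure (span (range (W' k)))" "\<pi> k x \<in> closure (span (range (W' k)))"
      using xy \<pi>H by (auto simp: rangeW' H_def)
    show "inner w y = inner w (\<pi> k x)" if w: "w \<in> range (W' k)" for w
      using w xy(3) \<pi>W[OF xy(1), of k] by (auto simp: W'_def)
  qed
  have H: "closed H" "subspace H" by (auto simp: H_def subspace_closure)
  have WH: "W i \<in> H" for i
    unfolding H_def using span_superset[of "range W"] closure_subset by blast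
  have iW: "\<i> *\<^sub>C W (g, b) = (if b then - W (g, False) else W (g, True))" for g b
    by (auto simp: W_def cscale_cscale cscale_minus_one)
  have cW: "c *\<^sub>C W (g, b) = Re c *\<^sub>R W (g, b) + Im c *\<^sub>R (if b then - W (g, False) else W (g, True))" for c g b
    by (simp only: cscale_Re_Im[of c] iW)
  have cH: "c *\<^sub>C x \<in> H" if "x \<in> H" for c x
  proof -
    interpret c: bounded_linear "\<lambda>x :: nat ell2. c *\<^sub>C x" by (rule bounded_linear_cscale)
    have "H \<subseteq> {x. c *\<^sub>C x \<in> H}" (is "_ \<subseteq> ?S")
      unfolding H_def
    proof (rule closure_span_minimal)
      show "range W \<subseteq> {x. c *\<^sub>C x \<in> closure (span (range W))}"
        unfolding H_def[symmetric]
        by (auto simp: cW intro!: subspace_add[OF H(2)] subspace_diff[OF H(2)] subspace_scale[OF H(2)] subspace_neg[OF H(2)] WH)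
      show "subspace {x. c *\<^sub>C x \<in> closure (span (range W))}"
        unfolding H_def[symmetric]
        by (intro subspaceI) (auto simp: c.zero c.add c.scaleR intro: subspace_0 subspace_add subspace_scale H)
      show "closed {x. c *\<^sub>C x \<in> closure (span (range W))}"
        using continuous_closed_vimage[OF closed_closure c.isCont[OF continuous_ident]]
        by (simp add: vimage_def)
    qed
    with that show ?thesis by blast
  qed
  have \<pi>c: "\<pi> k (c *\<^sub>C x) = c *\<^sub>C \<pi> k x" if x: "x \<in> H" for k c x
  proof (rule \<pi>I[symmetric])
    show "inner (W (k + g, b)) (c *\<^sub>C \<pi> k x) = inner (W (g, b)) (c *\<^sub>C x)" for g b
      using \<pi>W[OF x, of k "(g, True)"] \<pi>W[OF x, of k "(g, False)"]
      by (cases b) (simp_all add: inner_cscale_right cW inner_add_left inner_diff_left W'_def)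
  qed (use x cH \<pi>H in auto)
  have "unitary_rep H \<pi>"
    unfolding unitary_rep_def
  proof (intro conjI ballI allI)
    show "closed H" "0 \<in> H" using H subspace_0 by auto
    show "\<xi> + \<eta> \<in> H" "\<pi> g (\<xi> + \<eta>) = \<pi> g \<xi> + \<pi> g \<eta>" if "\<xi> \<in> H" "\<eta> \<in> H" for g \<xi> \<eta>
    proof -
      show s: "\<xi> + \<eta> \<in> H" using that H subspace_add by blast
      show "\<pi> g (\<xi> + \<eta>) = \<pi> g \<xi> + \<pi> g \<eta>"
        by (rule \<pi>I[symmetric])
          (use that s \<pi>H H(2) \<pi>W[of _ g] in \<open>auto simp: subspace_add inner_add_right W'_def split_paired_all\<close>)
    qed
    show "cinner (\<pi> g \<xi>) (\<pi> g \<eta>) = cinner \<xi> \<eta>" if "\<xi> \<in> H" "\<eta> \<in> H" for g \<xi> \<eta>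
      using that \<pi>inner cH by (simp add: cinner_conv_inner flip: \<pi>c)
    show "\<pi> 0 \<xi> = \<xi>" if "\<xi> \<in> H" for \<xi>
      by (rule \<pi>I[symmetric]) (use that in auto)
    show "\<pi> (g + h) \<xi> = \<pi> g (\<pi> h \<xi>)" if "\<xi> \<in> H" for g h \<xi>
      using \<pi>W[OF that, of h] \<pi>W[OF \<pi>H[OF that, of h], of g]
      by (intro \<pi>I[symmetric] \<pi>H that) (simp add: W'_def add.assoc split_paired_all)
  qed (use \<pi>H \<pi>c cH in auto)
  moreover have V0: "V 0 \<in> H" using WH[of "(0, False)"] by (simp add: W_def)
  moreover have "(norm (\<pi> g (V 0) - V 0))\<^sup>2 = 2 * A 0 0 - 2 * A g 0" for g
  proof -
    have "W (g, False) = \<pi> g (W (0, False))"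
      by (rule \<pi>I) (auto simp: WH W inv[of g _ 0, simplified])
    then have "\<pi> g (V 0) = V g" by (simp add: W_def)
    moreover have "A g g = A 0 0" using inv[of g 0 0] by simp
    ultimately show ?thesis
      using VV[of 0 g] VV[of g 0] by (simp add: power2_norm_eq_inner inner_diff_left inner_diff_right VV inner_commute)
  qed
  ultimately show ?thesis by (rule that)
qed

section \<open>Negative definite functions\<close>

text \<open>Negative definiteness tests only weights with sum zero. Adjoining the neutral element
  with the balancing weight makes arbitrary weights admissible, and its cross terms produce the
  summands \<open>d x\<close> and \<open>d y\<close>.\<close>

lemma neg_definite_psd:
  assumes "d \<in> ND\<^sub>0\<^sup>+"
  shows "psd (\<lambda>x y. d x + d y - d (- x + y))"
proof -
  have d0: "d 0 = 0" and dm: "\<And>g. d (- g) = d g" and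
    nd: "\<And>n (g :: nat \<Rightarrow> _) b. (\<Sum>i<n. b i) = 0 \<Longrightarrow>
        Re (\<Sum>i<n. \<Sum>j<n. cnj (b i) * b j * complex_of_real (d (- g i + g j))) \<le> 0"
    using assms by (auto simp: neg_definite_def)
  have sym: "d (- x + y) = d (- y + x)" for x y
    using dm[of "- x + y"] by (simp add: minus_add)
  have "0 \<le> (\<Sum>i<n. \<Sum>j<n. b i * b j * (d (g i) + d (g j) - d (- g i + g j)))"
    for n b and g :: "nat \<Rightarrow> _"
  proof -
    define b' where "b' = b(n := - (\<Sum>i<n. b i))"
    define g' where "g' = g(n := 0)"
    have "Re (\<Sum>i<Suc n. \<Sum>j<Suc n. cnj (complex_of_real (b' i)) * complex_of_real (b' j)
        * complex_of_real (d (- g' i + g' j))) \<le> 0"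
      by (rule nd) (simp add: b'_def less_imp_neq cong: sum.cong_simp)
    then have "(\<Sum>i<Suc n. \<Sum>j<Suc n. b' i * b' j * d (- g' i + g' j)) \<le> 0"
      by simp
    then have "(\<Sum>i<n. \<Sum>j<n. b i * b j * d (- g i + g j))
        - 2 * (\<Sum>i<n. b i) * (\<Sum>i<n. b i * d (g i)) \<le> 0"
      by (subst (asm) quadratic_form_Suc[OF sym])
        (simp add: b'_def g'_def d0 dm less_imp_neq cong: sum.cong_simp)
    moreover have "(\<Sum>i<n. \<Sum>j<n. b i * b j * (d (g i) + d (g j) - d (- g i + g j)))
        = (\<Sum>i<n. b i * d (g i)) * (\<Sum>j<n. b j) + (\<Sum>i<n. b i) * (\<Sum>j<n. b j * d (g j))
          - (\<Sum>i<n. \<Sum>j<n. b i * b j * d (- g i + g j))"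
      unfolding sum_product sum.distrib[symmetric] sum_subtractf[symmetric]
      by (intro sum.cong refl) (simp add: algebra_simps)
    ultimately show ?thesis by (simp add: algebra_simps)
  qed
  then show ?thesis using sym by (auto simp: psd_def)
qed

text \<open>The kernel is a rank-one kernel times the exponential of the positive semidefinite
  kernel from \<open>neg_definite_psd\<close>.\<close>

lemma schoenberg:
  assumes "d \<in> ND\<^sub>0\<^sup>+" "0 \<le> t"
  shows "psd (\<lambda>x y. exp (- t * d (- x + y)))"
proof -
  have "psd (\<lambda>x y. exp (- t * d x) * exp (- t * d y) * exp (t * (d x + d y - d (- x + y))))"
    by (intro psd_mult psd_rank_one psd_exp psd_scale neg_definite_psd assms)
  then show ?thesis
    unfolding exp_add[symmetric] by (simp add: algebra_simps)
qed

theorem property_T_neg_definite_bounded: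
  fixes d :: "'g::group_add \<Rightarrow> real"
  assumes "countable (UNIV :: 'g set)" "property_T TYPE('g)" and d: "d \<in> ND\<^sub>0\<^sup>+"
  obtains C where "\<And>g. d g \<le> C"
proof -
  have d0: "d 0 = 0" and dm: "\<And>g. d (- g) = d g" and dpos: "\<And>g. 0 \<le> d g"
    using d by (auto simp: neg_definite_def)
  obtain K :: "'g set" and \<epsilon> where K: "finite K" "\<epsilon> > 0"
    and T: "\<And>H (\<pi> :: 'g \<Rightarrow> nat ell2 \<Rightarrow> nat ell2) \<xi> \<delta> g. unitary_rep H \<pi> \<Longrightarrow> \<xi> \<in> H \<Longrightarrow> 0 < \<delta> \<Longrightarrow>
      (\<And>k. k \<in> K \<Longrightarrow> norm (\<pi> k \<xi> - \<xi>) < \<epsilon> * \<delta>) \<Longrightarrow> norm (\<pi> g \<xi> - \<xi>) \<le> 2 * \<delta>"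
    using property_T_almost_invariant[OF assms(2)] by metis
  \<comment> \<open>The property (T) estimate will be used with \<delta> = 1/2, so the squared
    displacement \<open>2 * \<eta>\<close> on \<open>K\<close> must lie below
    \<open>(\<epsilon> * (1/2))\<^sup>2\<close>; the divisor 4 makes this strict.\<close>
  define \<eta> where "\<eta> = min (1/2) ((\<epsilon> / 2)\<^sup>2 / 4)"
  have \<eta>: "0 < \<eta>" "\<eta> < 1" "2 * \<eta> < (\<epsilon> * (1/2))\<^sup>2"
    using K by (auto simp: \<eta>_def min_def)
  \<comment> \<open>A positive bound for \<open>d\<close> on \<open>K\<close>, also when
    \<open>K\<close> is empty or \<open>d\<close> vanishes there.\<close>
  define m where "m = 1 + Max (insert 0 (d ` K))"
  have m: "0 < m" "\<And>k. k \<in> K \<Longrightarrow> d k \<le> m"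
  proof -
    have "0 \<le> Max (insert 0 (d ` K))" using K by (intro Max_ge) auto
    then show "0 < m" by (simp add: m_def)
    show "d k \<le> m" if "k \<in> K" for k
    proof -
      have "d k \<le> Max (insert 0 (d ` K))" using K that by (intro Max_ge) auto
      then show ?thesis by (simp add: m_def)
    qed
  qed
  define t where "t = \<eta> / m"
  have t: "0 < t" using \<eta> m by (simp add: t_def)
  have near: "1 - exp (- t * d k) \<le> \<eta>" if "k \<in> K" for k
  proof -
    have "1 - exp (- t * d k) \<le> t * d k" using exp_ge_add_one_self[of "- t * d k"] by simp
    also have "\<dots> \<le> t * m" using m(2)[OF that] t by simp
    finally show ?thesis using m by (simp add: t_def)
  qed
  obtain H and \<pi> :: "'g \<Rightarrow> nat ell2 \<Rightarrow> nat ell2" and \<xi> where \<pi>: "unitary_rep H \<pi>" "\<xi> \<in> H"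
    and norm\<pi>: "\<And>g. (norm (\<pi> g \<xi> - \<xi>))\<^sup>2 = 2 - 2 * exp (- t * d g)"
  proof (rule gns_construction[OF assms(1) schoenberg[OF d less_imp_le[OF t]]])
    show "exp (- t * d (- (k + g) + (k + h))) = exp (- t * d (- g + h))" for k g h
      by (simp add: minus_add add.assoc[symmetric])
  qed (simp add: d0 dm)
  \<comment> \<open>A displacement of at most 1 stays below the square root of 2, the limiting value
    for unbounded \<open>d\<close>. Hence the exponential is at least 1/2 everywhere.\<close>
  have "norm (\<pi> g \<xi> - \<xi>) \<le> 2 * (1/2)" for g
  proof (rule T[OF \<pi>])
    fix k assume "k \<in> K"
    then have "(norm (\<pi> k \<xi> - \<xi>))\<^sup>2 \<le> 2 * \<eta>" using near[of k] norm\<pi>[of k] by simp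
    also have "\<dots> < (\<epsilon> * (1/2))\<^sup>2" by (rule \<eta>)
    finally show "norm (\<pi> k \<xi> - \<xi>) < \<epsilon> * (1/2)"
      by (rule power_less_imp_less_base) (use K in simp)
  qed simp
  then have "(norm (\<pi> g \<xi> - \<xi>))\<^sup>2 \<le> 1\<^sup>2" for g by (intro power_mono) auto
  then have "2 - 2 * exp (- t * d g) \<le> 1" for g unfolding norm\<pi> by simp
  then have "1 / 2 \<le> exp (- t * d g)" for g by (simp add: algebra_simps)
  then have ln: "ln (1 / 2) \<le> - t * d g" for g by (metis exp_gt_zero half_gt_zero zero_less_one ln_exp ln_le_cancel_iff)
  have "d g \<le> - ln (1 / 2) / t" for g using ln[of g] t by (simp add: field_simps)
  then show ?thesis by (rule that)
qed

section \<open>Bounded multipliers of unordered series\<close>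

text \<open>Cauchy criterion for the net of finite sums. It reduces convergence to finite sums off
  \<open>F0\<close>, where weights can be inserted.\<close>

lemma summable_on_iff_small_tails:
  fixes f :: "'a \<Rightarrow> 'b::banach"
  shows "f summable_on A \<longleftrightarrow>
    (\<forall>e>0. \<exists>F0. finite F0 \<and> F0 \<subseteq> A \<and> (\<forall>F. finite F \<longrightarrow> F \<subseteq> A - F0 \<longrightarrow> norm (sum f F) < e))"
    (is "_ \<longleftrightarrow> ?tails")
proof
  assume "f summable_on A"
  then obtain L where L: "(sum f \<longlongrightarrow> L) (finite_subsets_at_top A)"
    by (auto simp: summable_on_def has_sum_def)
  show ?tails
  proof (intro allI impI)
    fix e :: real assume "e > 0"
    then have "\<forall>\<^sub>F F in finite_subsets_at_top A. dist (sum f F) L < e / 2"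
      by (intro tendstoD[OF L]) simp
    then obtain F0 where F0: "finite F0" "F0 \<subseteq> A"
      "\<forall>F. finite F \<and> F0 \<subseteq> F \<and> F \<subseteq> A \<longrightarrow> dist (sum f F) L < e / 2"
      unfolding eventually_finite_subsets_at_top by blast
    have "norm (sum f F) < e" if F: "finite F" "F \<subseteq> A - F0" for F
    proof -
      have "sum f (F0 \<union> F) = sum f F0 + sum f F" using F F0 by (intro sum.union_disjoint) auto
      then have "norm (sum f F) = dist (sum f (F0 \<union> F)) (sum f F0)" by (simp add: dist_norm)
      also have "\<dots> < e"
      proof (rule dist_triangle_half_l)
        have "finite (F0 \<union> F)" "F0 \<union> F \<subseteq> A" using F F0 by auto
        with F0 show "dist (sum f (F0 \<union> F)) L < e / 2" "dist (sum f F0) L < e / 2" by simp_all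
      qed
      finally show ?thesis .
    qed
    with F0 show "\<exists>F0. finite F0 \<and> F0 \<subseteq> A \<and> (\<forall>F. finite F \<longrightarrow> F \<subseteq> A - F0 \<longrightarrow> norm (sum f F) < e)"
      by blast
  qed
next
  assume tails: ?tails
  have "\<exists>P. eventually P (finite_subsets_at_top A) \<and> (\<forall>F F'. P F \<and> P F' \<longrightarrow> dist (sum f F) (sum f F') < e)"
    if e: "e > 0" for e
  proof -
    obtain F0 where F0: "finite F0" "F0 \<subseteq> A"
      "\<And>F. finite F \<Longrightarrow> F \<subseteq> A - F0 \<Longrightarrow> norm (sum f F) < e / 2"
      using tails half_gt_zero[OF e] by metis
    define P where "P F \<longleftrightarrow> finite F \<and> F0 \<subseteq> F \<and> F \<subseteq> A" for F
    have "dist (sum f F) (sum f F0) < e / 2" if "P F" for F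
      using F0(3)[of "F - F0"] that F0(1) by (auto simp: P_def dist_norm sum_diff)
    then have "\<forall>F F'. P F \<and> P F' \<longrightarrow> dist (sum f F) (sum f F') < e"
      by (meson dist_triangle_half_l dist_commute)
    moreover have "eventually P (finite_subsets_at_top A)"
      unfolding eventually_finite_subsets_at_top P_def using F0 by blast
    ultimately show ?thesis by blast
  qed
  then have "cauchy_filter (filtermap (sum f) (finite_subsets_at_top A))"
    by (simp add: cauchy_filter_metric_filtermap)
  then obtain L where "(sum f \<longlongrightarrow> L) (finite_subsets_at_top A)"
    using complete_uniform[where S = "UNIV :: 'b set"] complete_UNIV_cuspace by (force simp: filterlim_def)
  then show "f summable_on A" by (auto simp: summable_on_def has_sum_def)
qed

text \<open>A sum with weights in \<open>[0, 1]\<close> is a convex combination of subset sums.\<close>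

lemma norm_weighted_sum_le:
  fixes f :: "'a \<Rightarrow> 'b::real_normed_vector"
  assumes "finite F" "\<And>x. x \<in> F \<Longrightarrow> 0 \<le> a x \<and> a x \<le> 1"
    and "\<And>G. G \<subseteq> F \<Longrightarrow> norm (v + sum f G) \<le> e"
  shows "norm (v + (\<Sum>x\<in>F. a x *\<^sub>R f x)) \<le> e"
  using assms
proof (induction F arbitrary: v)
  case (insert x F)
  let ?s = "\<Sum>x\<in>F. a x *\<^sub>R f x"
  have "norm (v + ?s) \<le> e"
    using insert.prems by (intro insert.IH) auto
  moreover have "norm (v + f x + ?s) \<le> e"
  proof (rule insert.IH)
    show "norm (v + f x + sum f G) \<le> e" if "G \<subseteq> F" for G
    proof -
      have "finite G" "x \<notin> G" using that insert.hyps finite_subset by auto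
      with insert.prems(2)[of "insert x G"] that show ?thesis by (auto simp: add.assoc)
    qed
  qed (use insert.prems in auto)
  \<comment> \<open>The weight of \<open>x\<close> interpolates between omitting \<open>x\<close>
    and including it fully; the offset \<open>v\<close> absorbs the included term in the
    induction.\<close>
  moreover have "v + (\<Sum>x\<in>insert x F. a x *\<^sub>R f x) = (1 - a x) *\<^sub>R (v + ?s) + a x *\<^sub>R (v + f x + ?s)"
    using insert.hyps by (simp add: algebra_simps)
  moreover have "0 \<le> a x" "a x \<le> 1" using insert.prems(1) by auto
  ultimately show ?case
    using convexD[OF convex_cball[of 0 e], of "v + ?s" "v + f x + ?s" "1 - a x" "a x"] by simp
qed auto

lemma summable_on_scaleR_bounded:
  fixes f :: "'a \<Rightarrow> 'b::banach"
  assumes f: "f summable_on A" and a: "\<And>x. x \<in> A \<Longrightarrow> 0 \<le> a x" "\<And>x. x \<in> A \<Longrightarrow> a x \<le> C"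
  shows "(\<lambda>x. a x *\<^sub>R f x) summable_on A"
proof -
  \<comment> \<open>Strictly positive for every real \<open>C\<close>, so dividing by it brings the
    weights into [0, 1].\<close>
  define B where "B = \<bar>C\<bar> + 1"
  have B: "0 < B" "\<And>x. x \<in> A \<Longrightarrow> a x \<le> B" using a(2) by (force simp: B_def)+
  have "(\<lambda>x. (a x / B) *\<^sub>R f x) summable_on A"
    unfolding summable_on_iff_small_tails
  proof (intro allI impI)
    fix e :: real assume "e > 0"
    then obtain F0 where F0: "finite F0" "F0 \<subseteq> A"
      "\<And>F. finite F \<Longrightarrow> F \<subseteq> A - F0 \<Longrightarrow> norm (sum f F) < e / 2"
      using f half_gt_zero unfolding summable_on_iff_small_tails by metis
    have "norm (\<Sum>x\<in>F. (a x / B) *\<^sub>R f x) < e" if F: "finite F" "F \<subseteq> A - F0" for F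
    proof -
      have "norm (0 + (\<Sum>x\<in>F. (a x / B) *\<^sub>R f x)) \<le> e / 2"
      proof (rule norm_weighted_sum_le[OF F(1)])
        show "0 \<le> a x / B \<and> a x / B \<le> 1" if "x \<in> F" for x
          using a(1)[of x] B F that by auto
        show "norm (0 + sum f G) \<le> e / 2" if "G \<subseteq> F" for G
          using F0(3)[of G] F that finite_subset[OF that] by fastforce
      qed
      with \<open>e > 0\<close> show ?thesis by simp
    qed
    with F0 show "\<exists>F0. finite F0 \<and> F0 \<subseteq> A \<and>
        (\<forall>F. finite F \<longrightarrow> F \<subseteq> A - F0 \<longrightarrow> norm (\<Sum>x\<in>F. (a x / B) *\<^sub>R f x) < e)"
      by blast
  qed
  then have "(\<lambda>x. B *\<^sub>R (a x / B) *\<^sub>R f x) summable_on A" by (rule summable_on_scaleR_right)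
  with B show ?thesis by simp
qed

section \<open>Multipliers of twisted group algebras\<close>

lemma op_cscale_add_right: "c *\<^sub>O (S + T) = c *\<^sub>O S + c *\<^sub>O T"
  by (rule blinfun_eqI)
    (simp add: op_cscale_apply blinfun.add_left bounded_linear.linear[OF bounded_linear_cscale] linear_add)

lemma op_cscale_add_left: "(a + b) *\<^sub>O T = a *\<^sub>O T + b *\<^sub>O T"
  by (rule blinfun_eqI) (simp add: op_cscale_apply blinfun.add_left cscale_add_left)

lemma op_cscale_op_cscale: "a *\<^sub>O b *\<^sub>O T = (a * b) *\<^sub>O T"
  by (rule blinfun_eqI) (simp add: op_cscale_apply cscale_cscale)

lemma op_cscale_of_real: "complex_of_real r *\<^sub>O T = r *\<^sub>R T"
  by (rule blinfun_eqI) (simp add: op_cscale_apply cscale_complex_of_real blinfun.scaleR_left)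

lemma op_cscale_one: "1 *\<^sub>O T = T"
  using op_cscale_of_real[of 1 T] by simp

lemma op_cscale_scaleR: "r *\<^sub>R c *\<^sub>O T = (of_real r * c) *\<^sub>O T" "c *\<^sub>O r *\<^sub>R T = (of_real r * c) *\<^sub>O T"
  by (simp_all add: op_cscale_op_cscale mult.commute flip: op_cscale_of_real)

lemma bounded_linear_op_cscale: "bounded_linear (\<lambda>T. c *\<^sub>O T)"
proof (rule bounded_linear_intro[where K = "cmod c"])
  show "norm (c *\<^sub>O T) \<le> norm T * cmod c" for T :: "'a ell2 \<Rightarrow>\<^sub>L 'a ell2"
  proof (rule norm_blinfun_bound)
    fix \<xi>
    have "cmod c * norm (blinfun_apply T \<xi>) \<le> cmod c * (norm T * norm \<xi>)"
      by (intro mult_left_mono norm_blinfun) simp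
    then show "norm (blinfun_apply (c *\<^sub>O T) \<xi>) \<le> norm T * cmod c * norm \<xi>"
      by (simp add: op_cscale_apply norm_cscale mult_ac)
  qed simp
qed (simp_all add: op_cscale_add_right op_cscale_scaleR)

lemma norm_power2_ell2: "(norm x)\<^sup>2 = (\<Sum>\<^sub>\<infinity>i. (cmod (coord x i))\<^sup>2)"
  by (simp add: norm_ell2_def infsum_nonneg)

lemma coord_sum: "coord (sum f F) i = (\<Sum>x\<in>F. coord (f x) i)"
  by (rule linear_sum[OF bounded_linear.linear[OF bounded_linear_coord]])

lemma coord_Lam_sum:
  assumes "\<sigma> \<in> Z\<^sup>2"
  shows "coord (blinfun_apply (\<Sum>g\<in>F. c g *\<^sub>O Lam \<sigma> g) \<xi>) k
    = (\<Sum>g\<in>F. c g * (\<sigma> g (- g + k) * coord \<xi> (- g + k)))"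
  by (simp add: blinfun.sum_left coord_sum op_cscale_apply cscale.rep_eq coord_Lam[OF assms])

text \<open>
  With \<open>\<phi>(kh\<inverse>) = \<Sum>\<^sub>i u\<^sub>i(k) u\<^sub>i(h)\<close> and \<open>D\<^sub>i\<close> the multiplication by \<open>u\<^sub>i\<close>, the multiplier sends
  \<open>x\<close> to \<open>\<Sum>\<^sub>i D\<^sub>i x D\<^sub>i\<close>, and \<open>\<Sum>\<^sub>i D\<^sub>i\<^sup>2 = 1\<close> because of \<open>\<phi>(e) = 1\<close>.
\<close>

lemma norm_multiplier_le:
  fixes \<sigma> :: "'g::group_add \<Rightarrow> 'g \<Rightarrow> complex" and \<phi> :: "'g \<Rightarrow> real"
  assumes "countable (UNIV :: 'g set)" and \<sigma>: "\<sigma> \<in> Z\<^sup>2"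
    and psd: "psd (\<lambda>x y. \<phi> (- x + y))" and \<phi>0: "\<phi> 0 = 1"
  shows "norm (\<Sum>g\<in>F. (of_real (\<phi> g) * c g) *\<^sub>O Lam \<sigma> g) \<le> norm (\<Sum>g\<in>F. c g *\<^sub>O Lam \<sigma> g)"
    (is "norm ?y \<le> norm ?x")
proof -
  obtain u :: "'g \<Rightarrow> nat \<Rightarrow> real" and N where
    u0: "\<And>k i. N k \<le> i \<Longrightarrow> u k i = 0" and
    u: "\<And>k h n. N k \<le> n \<Longrightarrow> (\<Sum>i<n. u k i * u h i) = \<phi> (k + - h)"
    \<comment> \<open>Passing to inverses gives the kernel \<open>\<phi> (k + - h)\<close>. The
      matrix entry of \<open>Lam \<sigma> g\<close> in row \<open>k\<close> sits in column
      \<open>h = - g + k\<close>, where \<open>k + - h = g\<close>.\<close>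
    using psd_gram_countable[OF psd_comp[OF psd, of uminus] assms(1)] by (metis minus_minus)
  have u_sq: "(\<Sum>i<n. (u k i)\<^sup>2) \<le> 1" for k n
  proof -
    have "(\<Sum>i<n. (u k i)\<^sup>2) \<le> (\<Sum>i<max n (N k). (u k i)\<^sup>2)" by (rule sum_mono2) auto
    also have "\<dots> = 1" using u[of k "max n (N k)" k] by (simp add: power2_eq_square \<phi>0)
    finally show ?thesis .
  qed
  have u_le: "(u k i)\<^sup>2 \<le> 1" for k i
    using u_sq[of k "Suc i"] sum_nonneg[of "{..<i}" "\<lambda>i. (u k i)\<^sup>2"] by simp
  define D where "D i \<xi> = Abs_ell2 (\<lambda>k. of_real (u k i) * coord \<xi> k)" for i and \<xi> :: "'g ell2"
  have D: "coord (D i \<xi>) k = of_real (u k i) * coord \<xi> k" for i k and \<xi> :: "'g ell2"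
  proof -
    have "(\<lambda>k. (cmod (of_real (u k i) * coord \<xi> k))\<^sup>2) summable_on UNIV"
    proof (rule summable_on_comparison_test[OF coord_summable[of \<xi>]])
      show "(cmod (of_real (u k i) * coord \<xi> k))\<^sup>2 \<le> (cmod (coord \<xi> k))\<^sup>2" for k
        using mult_right_mono[OF u_le[of k i] zero_le_power2[of "cmod (coord \<xi> k)"]]
        by (simp add: norm_mult power_mult_distrib)
    qed simp
    then show ?thesis by (simp add: D_def Abs_ell2_inverse)
  qed
  \<comment> \<open>The maps \<open>D i\<close> together form a contraction into a direct sum. The
    Cauchy-Schwarz estimate in the row \<open>k\<close> further on is the adjoint half of the same
    bound.\<close>
  have D_norm: "(\<Sum>i<n. (norm (D i \<xi>))\<^sup>2) \<le> (norm \<xi>)\<^sup>2" for n and \<xi> :: "'g ell2"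
  proof -
    have "((\<lambda>k. \<Sum>i<n. (cmod (coord (D i \<xi>) k))\<^sup>2) has_sum (\<Sum>i<n. (norm (D i \<xi>))\<^sup>2)) UNIV"
      unfolding norm_power2_ell2 by (induction n) (auto intro!: has_sum_add has_sum_infsum coord_summable)
    moreover have "((\<lambda>k. (cmod (coord \<xi> k))\<^sup>2) has_sum (norm \<xi>)\<^sup>2) UNIV"
      unfolding norm_power2_ell2 by (intro has_sum_infsum coord_summable)
    moreover have "(\<Sum>i<n. (cmod (coord (D i \<xi>) k))\<^sup>2) \<le> (cmod (coord \<xi> k))\<^sup>2" for k
      using mult_right_mono[OF u_sq[of k n] zero_le_power2[of "cmod (coord \<xi> k)"]]
      by (simp add: D norm_mult power_mult_distrib sum_distrib_right)
    ultimately show ?thesis by (rule has_sum_mono)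
  qed
  show ?thesis
  proof (rule norm_blinfun_bound)
    fix \<xi>
    show "norm (blinfun_apply ?y \<xi>) \<le> norm ?x * norm \<xi>"
    proof (rule norm_le_if_sum_coord_le)
      fix K :: "'g set" assume K: "finite K"
      \<comment> \<open>A common bound for the supports of all \<open>u k\<close> with
        \<open>k\<close> in \<open>K\<close>: in these rows the sum over \<open>i\<close> is finite
        and exact.\<close>
      define n where "n = (\<Sum>k\<in>K. N k)"
      have Nn: "N k \<le> n" if "k \<in> K" for k
        unfolding n_def using K that by (intro member_le_sum) auto
      define z where "z i = blinfun_apply ?x (D i \<xi>)" for i
      have y: "coord (blinfun_apply ?y \<xi>) k = (\<Sum>i<n. of_real (u k i) * coord (z i) k)" if "k \<in> K" for k
      proof -
        have "(\<Sum>i<n. of_real (u k i) * coord (z i) k) =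
            (\<Sum>i<n. \<Sum>g\<in>F. of_real (u k i * u (- g + k) i) * (c g * (\<sigma> g (- g + k) * coord \<xi> (- g + k))))"
          by (simp add: z_def coord_Lam_sum[OF \<sigma>] D sum_distrib_left mult_ac)
        also have "\<dots> = (\<Sum>g\<in>F. of_real (\<Sum>i<n. u k i * u (- g + k) i)
            * (c g * (\<sigma> g (- g + k) * coord \<xi> (- g + k))))"
          by (subst sum.swap) (simp add: sum_distrib_right)
        also have "\<dots> = (\<Sum>g\<in>F. of_real (\<phi> g) * (c g * (\<sigma> g (- g + k) * coord \<xi> (- g + k))))"
          by (simp only: u[OF Nn[OF that]]) (simp add: minus_add add.assoc[symmetric])
        finally show ?thesis by (simp add: coord_Lam_sum[OF \<sigma>] mult_ac)
      qed
      have "(cmod (coord (blinfun_apply ?y \<xi>) k))\<^sup>2 \<le> (\<Sum>i<n. (cmod (coord (z i) k))\<^sup>2)" if "k \<in> K" for k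
      proof -
        have "cmod (coord (blinfun_apply ?y \<xi>) k) \<le> (\<Sum>i<n. \<bar>u k i\<bar> * cmod (coord (z i) k))"
          unfolding y[OF that] by (rule sum_norm_le) (simp add: norm_mult)
        then have "(cmod (coord (blinfun_apply ?y \<xi>) k))\<^sup>2 \<le> (\<Sum>i<n. \<bar>u k i\<bar> * cmod (coord (z i) k))\<^sup>2"
          by (intro power_mono) auto
        also have "\<dots> \<le> (\<Sum>i<n. \<bar>u k i\<bar>\<^sup>2) * (\<Sum>i<n. (cmod (coord (z i) k))\<^sup>2)"
          by (rule Cauchy_Schwarz_ineq_sum)
        also have "\<dots> \<le> 1 * (\<Sum>i<n. (cmod (coord (z i) k))\<^sup>2)"
          using u_sq[where k = k and n = n] by (intro mult_right_mono sum_nonneg) auto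
        finally show ?thesis by simp
      qed
      then have "(\<Sum>k\<in>K. (cmod (coord (blinfun_apply ?y \<xi>) k))\<^sup>2)
          \<le> (\<Sum>k\<in>K. \<Sum>i<n. (cmod (coord (z i) k))\<^sup>2)"
        by (rule sum_mono)
      also have "\<dots> = (\<Sum>i<n. \<Sum>k\<in>K. (cmod (coord (z i) k))\<^sup>2)" by (rule sum.swap)
      also have "\<dots> \<le> (\<Sum>i<n. (norm (z i))\<^sup>2)" by (intro sum_mono sum_coord_le_norm K)
      also have "\<dots> \<le> (\<Sum>i<n. (norm ?x * norm (D i \<xi>))\<^sup>2)"
        unfolding z_def by (intro sum_mono power_mono norm_blinfun) simp
      also have "\<dots> = (norm ?x)\<^sup>2 * (\<Sum>i<n. (norm (D i \<xi>))\<^sup>2)"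
        by (simp add: power_mult_distrib sum_distrib_left)
      also have "\<dots> \<le> (norm ?x)\<^sup>2 * (norm \<xi>)\<^sup>2" by (intro mult_left_mono D_norm) simp
      finally show "(\<Sum>k\<in>K. (cmod (coord (blinfun_apply ?y \<xi>) k))\<^sup>2) \<le> (norm ?x * norm \<xi>)\<^sup>2"
        by (simp add: power_mult_distrib)
    qed simp
  qed simp
qed

section \<open>Existence of the multiplier\<close>

text \<open>The abstract \<open>v\<close> covers both the span of the \<open>Lam \<sigma> g\<close>
  and the graph of the multiplier on it. Coefficients are extended by zero to a common
  support.\<close>

lemma subspace_finite_sums:
  fixes v :: "'g \<Rightarrow> complex \<Rightarrow> 'b::real_vector"
  assumes add: "\<And>g a b. v g (a + b) = v g a + v g b"
    and scale: "\<And>g r a. r *\<^sub>R v g a = v g (of_real r * a)"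
  shows "subspace {\<Sum>g\<in>F. v g (c g) | F c. finite F}" (is "subspace ?S")
proof (rule subspaceI)
  have zero: "v g 0 = 0" for g using scale[of 0 g 0] by simp
  have extend: "(\<Sum>g\<in>F. v g (c g)) = (\<Sum>g\<in>G. v g (if g \<in> F then c g else 0))" if "finite G" "F \<subseteq> G" for F G c
    using that by (intro sum.mono_neutral_cong_left) (auto simp: zero)
  have sum_S: "(\<Sum>g\<in>F. v g (c g)) \<in> ?S" if "finite F" for F c using that by blast
  show "0 \<in> ?S" using sum_S[of "{}"] by simp
  show "x + y \<in> ?S" if xy: "x \<in> ?S" "y \<in> ?S" for x y
  proof -
    obtain F c F' c' where x: "finite F" "x = (\<Sum>g\<in>F. v g (c g))"
      and y: "finite F'" "y = (\<Sum>g\<in>F'. v g (c' g))" using xy by blast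
    have "x + y = (\<Sum>g\<in>F \<union> F'. v g ((if g \<in> F then c g else 0) + (if g \<in> F' then c' g else 0)))"
      unfolding x(2) y(2) add sum.distrib using x(1) y(1) by (intro arg_cong2[of _ _ _ _ "(+)"] extend) auto
    with x(1) y(1) show ?thesis
      using sum_S[of "F \<union> F'" "\<lambda>g. (if g \<in> F then c g else 0) + (if g \<in> F' then c' g else 0)"] by simp
  qed
  show "r *\<^sub>R x \<in> ?S" if "x \<in> ?S" for r x
  proof -
    obtain F c where x: "finite F" "x = (\<Sum>g\<in>F. v g (c g))" using \<open>x \<in> ?S\<close> by blast
    have "r *\<^sub>R x = (\<Sum>g\<in>F. v g (of_real r * c g))" by (simp add: x(2) scaleR_sum_right scale)
    with x(1) show ?thesis using sum_S[of F "\<lambda>g. of_real r * c g"] by simp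
  qed
qed

lemma subspace_Cr: "subspace (Cr \<sigma>)"
  unfolding Cr_def
  by (intro subspace_closure subspace_finite_sums[where v = "\<lambda>g c. c *\<^sub>O Lam \<sigma> g"])
    (simp_all add: op_cscale_add_left op_cscale_scaleR)

text \<open>The contraction bound on finite sums makes \<open>R\<close> a graph and extends it to
  \<open>Cr \<sigma>\<close>. Each property of \<open>M\<close> is then obtained by exhibiting a
  pair in \<open>closure R\<close>.\<close>

lemma multiplier_exists:
  fixes \<sigma> :: "'g::group_add \<Rightarrow> 'g \<Rightarrow> complex" and \<phi> :: "'g \<Rightarrow> real"
  assumes "countable (UNIV :: 'g set)" and \<sigma>: "\<sigma> \<in> Z\<^sup>2"
    and psd: "psd (\<lambda>x y. \<phi> (- x + y))" and \<phi>0: "\<phi> 0 = 1"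
  obtains M where "bounded_operator_on_Cr \<sigma> M" "\<And>g. M (Lam \<sigma> g) = of_real (\<phi> g) *\<^sub>O Lam \<sigma> g"
proof -
  define v where "v g c = (c *\<^sub>O Lam \<sigma> g, (of_real (\<phi> g) * c) *\<^sub>O Lam \<sigma> g)" for g c
  define R where "R = {\<Sum>g\<in>F. v g (c g) | F c. finite F}"
  have v_sum: "(\<Sum>g\<in>F. v g (c g)) = (\<Sum>g\<in>F. c g *\<^sub>O Lam \<sigma> g, \<Sum>g\<in>F. (of_real (\<phi> g) * c g) *\<^sub>O Lam \<sigma> g)" for F c
    by (simp add: v_def sum_prod)
  have sum_R: "(\<Sum>g\<in>F. v g (c g)) \<in> R" if "finite F" for F c using that by (auto simp: R_def)
  have R: "subspace R"
    unfolding R_def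
    by (rule subspace_finite_sums) (simp_all add: v_def op_cscale_add_left op_cscale_scaleR algebra_simps)
  have norm_R: "norm (snd p) \<le> 1 * norm (fst p)" if "p \<in> R" for p
    using that norm_multiplier_le[OF assms] by (auto simp: R_def v_sum)
  have fstR: "closure (fst ` R) = Cr \<sigma>"
  proof -
    have "fst ` R = {\<Sum>g\<in>F. c g *\<^sub>O Lam \<sigma> g | F c. finite F}"
      by (force simp: R_def v_sum)
    then show ?thesis by (simp add: Cr_def)
  qed
  obtain M where M: "\<And>x y. x \<in> Cr \<sigma> \<Longrightarrow> (x, y) \<in> closure R \<longleftrightarrow> y = M x"
    using closure_graph_bounded[OF R norm_R] unfolding fstR by metis
  then have xM: "(x, M x) \<in> closure R" if "x \<in> Cr \<sigma>" for x using that by blast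
  \<comment> \<open>The extension is a real one; complex homogeneity comes from stability of
    \<open>R\<close>, hence of its closure, under complex scalars.\<close>
  have cR: "(c *\<^sub>O x, c *\<^sub>O y) \<in> closure R" if "(x, y) \<in> closure R" for c x y
  proof -
    interpret c: bounded_linear "\<lambda>T :: 'g ell2 \<Rightarrow>\<^sub>L 'g ell2. c *\<^sub>O T" by (rule bounded_linear_op_cscale)
    have "(\<lambda>p. (c *\<^sub>O fst p, c *\<^sub>O snd p)) ` R \<subseteq> R"
    proof safe
      fix a b assume "(a, b) \<in> R"
      then obtain F k where "finite F" "(a, b) = (\<Sum>g\<in>F. v g (k g))" by (auto simp: R_def)
      then have "(c *\<^sub>O fst (a, b), c *\<^sub>O snd (a, b)) = (\<Sum>g\<in>F. v g (c * k g))"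
        by (simp add: v_sum c.sum op_cscale_op_cscale mult_ac)
      with sum_R[OF \<open>finite F\<close>, of "\<lambda>g. c * k g"] show "(c *\<^sub>O fst (a, b), c *\<^sub>O snd (a, b)) \<in> R"
        by simp
    qed
    moreover have "(\<lambda>p. (c *\<^sub>O fst p, c *\<^sub>O snd p)) ` closure R \<subseteq> closure ((\<lambda>p. (c *\<^sub>O fst p, c *\<^sub>O snd p)) ` R)"
      by (intro continuous_image_closure_subset[of UNIV] continuous_intros c.continuous_on) auto
    ultimately have "(\<lambda>p. (c *\<^sub>O fst p, c *\<^sub>O snd p)) ` closure R \<subseteq> closure R"
      using closure_mono by (meson order_trans)
    from subsetD[OF this imageI[OF that]] show ?thesis by simp
  qed
  show ?thesis
  proof (rule that)
    show "bounded_operator_on_Cr \<sigma> M"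
      unfolding bounded_operator_on_Cr_def
    proof (intro conjI ballI allI exI)
      fix x assume x: "x \<in> Cr \<sigma>"
      have "snd ` R \<subseteq> fst ` R"
      proof safe
        fix a b assume "(a, b) \<in> R"
        then obtain F k where F: "finite F" "(a, b) = (\<Sum>g\<in>F. v g (k g))" by (auto simp: R_def)
        then have "b = fst (\<Sum>g\<in>F. v g (of_real (\<phi> g) * k g))" by (simp add: v_sum)
        with sum_R[OF F(1)] show "snd (a, b) \<in> fst ` R" by simp
      qed
      moreover have "snd ` closure R \<subseteq> closure (snd ` R)"
        by (intro continuous_image_closure_subset[of UNIV] continuous_intros) auto
      ultimately show "M x \<in> Cr \<sigma>"
        using xM[OF x] closure_mono[of "snd ` R" "fst ` R"] fstR by force
      show "M (c *\<^sub>O x) = c *\<^sub>O M x" for c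
      proof -
        have "fst ` closure R \<subseteq> closure (fst ` R)"
          by (intro continuous_image_closure_subset[of UNIV] continuous_intros) auto
        with cR[OF xM[OF x], of c] have "c *\<^sub>O x \<in> Cr \<sigma>" unfolding fstR by force
        from M[OF this] show ?thesis using cR[OF xM[OF x], of c] by simp
      qed
      have "closure R \<subseteq> {p. norm (snd p) \<le> 1 * norm (fst p)}"
        using norm_R by (intro closure_minimal closed_Collect_le continuous_intros) auto
      then show "norm (M x) \<le> 1 * norm x" using xM[OF x] by force
      fix y assume y: "y \<in> Cr \<sigma>"
      show "M (x + y) = M x + M y"
        using M[OF subspace_add[OF subspace_Cr x y]] subspace_add[OF subspace_closure[OF R] xM[OF x] xM[OF y]]
        by simp
    qed
    show "M (Lam \<sigma> g) = of_real (\<phi> g) *\<^sub>O Lam \<sigma> g" for g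
    proof -
      have g: "(Lam \<sigma> g, of_real (\<phi> g) *\<^sub>O Lam \<sigma> g) \<in> R"
        using sum_R[of "{g}" "\<lambda>_. 1"] by (simp add: v_def op_cscale_one)
      then have "Lam \<sigma> g \<in> Cr \<sigma>" unfolding fstR[symmetric] using closure_subset by force
      moreover have "(Lam \<sigma> g, of_real (\<phi> g) *\<^sub>O Lam \<sigma> g) \<in> closure R"
        using g closure_subset by (rule subsetD[rotated])
      ultimately show ?thesis using M by simp
    qed
  qed
qed

section \<open>Fourier coefficients and the comparison of the two series\<close>

lemma bounded_linear_fourier: "bounded_linear (\<lambda>x. fourier x g)"
  unfolding fourier_def
  by (intro bounded_linear_compose[OF bounded_linear_coord] blinfun.bounded_linear_left)

lemma fourier_op_cscale: "fourier (c *\<^sub>O x) g = c * fourier x g"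
  by (simp add: fourier_def op_cscale_apply cscale.rep_eq)

lemma fourier_Lam: "\<sigma> \<in> Z\<^sup>2 \<Longrightarrow> fourier (Lam \<sigma> h) g = (if g = h then 1 else 0)"
  by (simp add: fourier_def Lam_delta cscale.rep_eq delta.rep_eq) (simp add: cocycles_def)

text \<open>Both sides are continuous in \<open>x\<close>, so finite sums decide. \<open>M\<close>
  is kept abstract because only these properties are known of the operator that the choice in
  \<open>multiplier\<close> selects.\<close>

lemma fourier_multiplier:
  assumes \<sigma>: "\<sigma> \<in> Z\<^sup>2" and M: "bounded_operator_on_Cr \<sigma> M"
    and M_Lam: "\<And>g. M (Lam \<sigma> g) = of_real (\<phi> g) *\<^sub>O Lam \<sigma> g" and x: "x \<in> Cr \<sigma>"
  shows "fourier (M x) g = of_real (\<phi> g) * fourier x g"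
proof -
  interpret f: bounded_linear "\<lambda>x. fourier x g" by (rule bounded_linear_fourier)
  define S where "S = {\<Sum>g\<in>F. c g *\<^sub>O Lam \<sigma> g | F c. finite F}"
  have CrS: "Cr \<sigma> = closure S" by (simp add: Cr_def S_def)
  have SCr: "x \<in> Cr \<sigma>" if "x \<in> S" for x
    unfolding CrS using that closure_subset by blast
  have sum_S: "(\<Sum>g\<in>F. c g *\<^sub>O Lam \<sigma> g) \<in> S" if "finite F" for F c using that by (auto simp: S_def)
  have Lam_Cr: "Lam \<sigma> h \<in> Cr \<sigma>" "c *\<^sub>O Lam \<sigma> h \<in> Cr \<sigma>" for h c
    using SCr[OF sum_S[of "{h}" "\<lambda>_. 1"]] SCr[OF sum_S[of "{h}" "\<lambda>_. c"]] by (simp_all add: op_cscale_one)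
  have M_add: "M (x + y) = M x + M y" if "x \<in> Cr \<sigma>" "y \<in> Cr \<sigma>" for x y
    using M that unfolding bounded_operator_on_Cr_def by blast
  have M_scale: "M (c *\<^sub>O x) = c *\<^sub>O M x" if "x \<in> Cr \<sigma>" for c x
    using M that unfolding bounded_operator_on_Cr_def by blast
  obtain C where C: "\<And>x. x \<in> Cr \<sigma> \<Longrightarrow> norm (M x) \<le> C * norm x"
    using M unfolding bounded_operator_on_Cr_def by blast
  have M0: "M 0 = 0" using C[OF subspace_0[OF subspace_Cr]] by simp
  have on_S: "fourier (M x) g = of_real (\<phi> g) * fourier x g" if xS: "x \<in> S" for x
  proof -
    obtain F c where F: "finite F" and x: "x = (\<Sum>g\<in>F. c g *\<^sub>O Lam \<sigma> g)"
      using xS by (auto simp: S_def)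
    show ?thesis
      unfolding x using F
    proof (induction F)
      case (insert h F)
      then show ?case
        by (simp add: M_add Lam_Cr SCr sum_S M_scale M_Lam f.add fourier_op_cscale fourier_Lam[OF \<sigma>] ring_distribs)
    qed (simp add: M0 f.zero)
  qed
  obtain X where X: "\<And>n. X n \<in> S" "X \<longlonglongrightarrow> x"
    using x unfolding CrS closure_sequential by metis
  have "(\<lambda>n. M (X n)) \<longlonglongrightarrow> M x"
  proof -
    have "norm (M (X n) - M x) \<le> C * norm (X n - x)" for n
    proof -
      have d: "X n - x \<in> Cr \<sigma>" by (intro subspace_diff subspace_Cr SCr X x)
      from M_add[OF d x] have "M (X n) - M x = M (X n - x)" by simp
      then show ?thesis using C[OF d] by simp
    qed
    moreover have "(\<lambda>n. C * norm (X n - x)) \<longlonglongrightarrow> 0"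
      using X(2) by (intro tendsto_mult_right_zero tendsto_norm_zero LIM_zero)
    ultimately have "(\<lambda>n. M (X n) - M x) \<longlonglongrightarrow> 0"
      by (intro Lim_null_comparison[of "\<lambda>n. M (X n) - M x"]) auto
    then show ?thesis by (simp add: LIM_zero_iff)
  qed
  from f.tendsto[OF this] have "(\<lambda>n. of_real (\<phi> g) * fourier (X n) g) \<longlonglongrightarrow> fourier (M x) g"
    by (simp add: on_S X(1))
  moreover have "(\<lambda>n. of_real (\<phi> g) * fourier (X n) g) \<longlonglongrightarrow> of_real (\<phi> g) * fourier x g"
    by (intro tendsto_intros f.tendsto X(2))
  ultimately show ?thesis by (rule LIMSEQ_unique)
qed

theorem corollary3p5:
  fixes \<sigma> :: "'g::group_add \<Rightarrow> 'g \<Rightarrow> complex"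
    and x\<^sub>0 :: "'g ell2 \<Rightarrow>\<^sub>L 'g ell2"
    and d :: "'g \<Rightarrow> real"
  assumes "countable (UNIV :: 'g set)" and "infinite (UNIV :: 'g set)"
    and "property_T TYPE('g)"
    and "\<sigma> \<in> Z\<^sup>2"
    and "x\<^sub>0 \<in> Cr \<sigma>"
    and "d \<in> ND\<^sub>0\<^sup>+"
  shows "conv_times \<sigma> d x\<^sub>0 = (if x\<^sub>0 \<in> CF \<sigma> then {0..} else {})"
proof -
  have d: "0 \<le> d g" "d 0 = 0" for g using assms(6) by (auto simp: neg_definite_def)
  obtain C where C: "\<And>g. d g \<le> C"
    using property_T_neg_definite_bounded[OF assms(1,3,6)] by blast
  have "multiplier \<sigma> d t x\<^sub>0 \<in> CF \<sigma> \<longleftrightarrow> x\<^sub>0 \<in> CF \<sigma>" if t: "0 \<le> t" for t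
  proof -
    let ?M = "multiplier \<sigma> d t"
    let ?f = "\<lambda>g. fourier x\<^sub>0 g *\<^sub>O Lam \<sigma> g"
    have "\<exists>M. bounded_operator_on_Cr \<sigma> M \<and> (\<forall>g. M (Lam \<sigma> g) = complex_of_real (exp (- t * d g)) *\<^sub>O Lam \<sigma> g)"
      using multiplier_exists[OF assms(1,4) schoenberg[OF assms(6) t]] d(2) by auto
    from someI_ex[OF this] have M: "bounded_operator_on_Cr \<sigma> ?M"
      and M_Lam: "\<And>g. ?M (Lam \<sigma> g) = complex_of_real (exp (- t * d g)) *\<^sub>O Lam \<sigma> g"
      unfolding multiplier_def by blast+
    have "?M x\<^sub>0 \<in> Cr \<sigma>" using M assms(5) by (simp add: bounded_operator_on_Cr_def)
    moreover have "(\<lambda>g. fourier (?M x\<^sub>0) g *\<^sub>O Lam \<sigma> g) = (\<lambda>g. exp (- t * d g) *\<^sub>R ?f g)"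
      by (simp only: fourier_multiplier[OF assms(4) M M_Lam assms(5)] op_cscale_scaleR)
    moreover have "(\<lambda>g. exp (- t * d g) *\<^sub>R ?f g) summable_on UNIV \<longleftrightarrow> ?f summable_on UNIV"
    proof
      assume "?f summable_on UNIV"
      then show "(\<lambda>g. exp (- t * d g) *\<^sub>R ?f g) summable_on UNIV"
        by (rule summable_on_scaleR_bounded[where C = 1]) (use t d in auto)
    next
      assume "(\<lambda>g. exp (- t * d g) *\<^sub>R ?f g) summable_on UNIV"
      \<comment> \<open>Undoing the multiplier takes the weights \<open>exp (t * d g)\<close>. Their
        bound \<open>exp (t * C)\<close> is where property (T) enters.\<close>
      then have "(\<lambda>g. exp (t * d g) *\<^sub>R exp (- t * d g) *\<^sub>R ?f g) summable_on UNIV"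
        by (rule summable_on_scaleR_bounded[where C = "exp (t * C)"]) (use t C in \<open>auto intro: mult_left_mono\<close>)
      then show "?f summable_on UNIV" by (simp flip: exp_add)
    qed
    ultimately show ?thesis using assms(5) by (simp add: CF_def)
  qed
  then show ?thesis by (auto simp: conv_times_def)
qed

end
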